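(* Let $(X,o)$ be a germ of a complex algebraic variety, and let $\nu_1,\ldots,\nu_r$ ($r\ge 1$) be discrete valuations of the function field $\mathbb{C}(X)$ whose valuation rings contain $\mathcal{O}_{X,o}$. Suppose that $\nu_r$ is centered at the maximal ideal $\mathsf{m}$ of $\mathcal{O}_{X,o}$. Then the series $$\sum_{\underline{v}\in\mathbb{Z}^r}\left(\sum_{i=0}^{r-1}(-1)^i h_i^{\underline{v}}\right)\underline{t}^{\underline{v}}$$ coincides with the Poincaré series $$\sum_{\underline{v}\in\mathbb{Z}^r}\left(\sum_{K\subset\{1,\ldots,r-1\}}(-1)^{\#K}\dim\frac{M(\underline{v}+\underline{e}_K)}{M(\underline{v}+\underline{e}_K+\underline{e}_r)}\right)\underline{t}^{\underline{v}},$$ and, whenever the latter is defined (i.e. whenever $\dim M(\underline{v})/M(\underline{v}+\underline{1})<\infty$ for all $\underline{v}\in\mathbb{Z}^r$), it coincides with the Poincaré series $$\frac{\prod_{j=1}^{r}(t_j-1)}{t_1\cdots t_r-1}\sum_{\underline{v}\in\mathbb{Z}^r}\dim\big(M(\underline{v})/M(\underline{v}+\underline{1})\big)\,\underline{t}^{\underline{v}}.$$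
   Context: $\mathcal{O}_{X,o}$ is the local ring of germs of functions on $(X,o)$, with maximal ideal $\mathsf{m}$. The center of $\nu_j$ is the prime ideal $\{f\in\mathcal{O}_{X,o}\mid \nu_j(f)>0\}$. All dimensions are over $\mathbb{C}$. For $\underline{v}\in\mathbb{Z}^r$ put $M(\underline{v})=\{g\in\mathcal{O}_{X,o}\mid \nu_j(g)\ge v_j,\ 1\le j\le r\}$. For $I\subseteq\{1,\ldots,r\}$, $\underline{e}_I\in\mathbb{Z}^r$ has $j$-th component $1$ if $j\in I$ and $0$ otherwise; $\underline{e}_j=\underline{e}_{\{j\}}$; $\underline{1}=(1,\ldots,1)$; $\underline{t}^{\underline{v}}=t_1^{v_1}\cdots t_r^{v_r}$. In the last series, the product of $\prod_j(t_j-1)$ with the sum over $\mathbb{Z}^r$ is a power series in $t_1,\ldots,t_r$ with only nonnegative exponents (the other coefficients vanish), and it is divided by $t_1\cdots t_r-1$ in the ring of formal power series. The numbers $h_i^{\underline{v}}$: fix $\underline{v}\in\mathbb{Z}^r$ and put $V_I=M(\underline{v}+\underline{e}_I)/M(\underline{v}+\underline{1})$ for $I\subseteq\{1,\ldots,r\}$. Let $C_i=\bigoplus_{\#I=i}V_I$ for $0\le i\le r$, and $C_i=0$ for $i=-1$ and $i>r$. For $I=\{a_1<\cdots<a_{i+1}\}$ the map $\partial_{i+1}:C_{i+1}\to C_i$ sends $x\in V_I$ to the element $(y_J)_{\#J=i}$ with $y_J=(-1)^k x$ if $J=I\setminus\{a_k\}$ (viewing $V_I\subseteq V_J$ via $M(\underline{v}+\underline{e}_I)\subseteq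 M(\underline{v}+\underline{e}_J)$) and $y_J=0$ if $J\not\subseteq I$; all remaining $\partial_i$ (to or from a zero space) are zero. This is a complex of vector spaces, and $h_i^{\underline{v}}=\dim(\ker\partial_i/\operatorname{im}\partial_{i+1})$. *)

theory Defs
  imports
    "HOL-Library.Cardinality"
    "HOL-Library.Function_Algebras"
    "HOL-Library.Poly_Mapping"
    "HOL-Algebra.AbelCoset"
    "Jordan_Normal_Form.VS_Connect"
begin

section \<open>Germs of varieties and valuations\<close>

inductive_set generated_algebra :: "(complex \<Rightarrow> 'k::field) \<Rightarrow> 'k set \<Rightarrow> 'k set"
  for \<iota> :: "complex \<Rightarrow> 'k" and S :: "'k set" where
  const: "\<iota> c \<in> generated_algebra \<iota> S"
| gen: "x \<in> S \<Longrightarrow> x \<in> generated_algebra \<iota> S"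
| add: "x \<in> generated_algebra \<iota> S \<Longrightarrow> y \<in> generated_algebra \<iota> S \<Longrightarrow> x + y \<in> generated_algebra \<iota> S"
| mult: "x \<in> generated_algebra \<iota> S \<Longrightarrow> y \<in> generated_algebra \<iota> S \<Longrightarrow> x * y \<in> generated_algebra \<iota> S"

text \<open>
  A germ \<open>(X, o)\<close> of an irreducible complex variety is given by an affine neighbourhood of \<open>o\<close>:
  the type \<open>'k\<close> is the function field of \<open>X\<close>, \<open>\<iota>\<close> is the inclusion of the constants, \<open>A\<close> is the
  coordinate ring of the neighbourhood (a finitely generated algebra with field of fractions
  \<open>'k\<close>), and \<open>ev\<close> is evaluation at \<open>o\<close>, i.e. \<open>ev f = f(o)\<close> for \<open>f \<in> A\<close>. Points of an affine variety
  are exactly the algebra homomorphisms from its coordinate ring to the complex numbers.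
  The values of \<open>ev\<close> outside \<open>A\<close> are irrelevant.
\<close>

definition variety_germ :: "(complex \<Rightarrow> 'k::field) \<Rightarrow> 'k set \<Rightarrow> ('k \<Rightarrow> complex) \<Rightarrow> bool" where
  "variety_germ \<iota> A ev \<longleftrightarrow>
     field_hom \<iota> \<and>
     (\<exists>S. finite S \<and> A = generated_algebra \<iota> S) \<and>
     (\<forall>x. \<exists>a\<in>A. \<exists>b\<in>A. b \<noteq> 0 \<and> x = a / b) \<and>
     ev \<in> Ring.ring_hom (class_ring\<lparr>carrier := A\<rparr>) class_ring \<and>
     (\<forall>c. ev (\<iota> c) = c)"

definition local_ring :: "'k::field set \<Rightarrow> ('k \<Rightarrow> complex) \<Rightarrow> 'k set" where
  "local_ring A ev = {a / s | a s. a \<in> A \<and> s \<in> A \<and> ev s \<noteq> 0}"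

definition local_max_ideal :: "'k::field set \<Rightarrow> ('k \<Rightarrow> complex) \<Rightarrow> 'k set" where
  "local_max_ideal A ev = {a / s | a s. a \<in> A \<and> s \<in> A \<and> ev s \<noteq> 0 \<and> ev a = 0}"

text \<open>
  Valuations are integer-valued functions on the nonzero elements. The convention
  \<open>\<nu>(0) = \<infinity>\<close> is made explicit by \<open>val_ge\<close>, so the value of \<open>\<nu>\<close> at \<open>0\<close> is irrelevant.
\<close>

definition discrete_valuation :: "('k::field \<Rightarrow> int) \<Rightarrow> bool" where
  "discrete_valuation \<nu> \<longleftrightarrow>
     (\<forall>x y. x \<noteq> 0 \<longrightarrow> y \<noteq> 0 \<longrightarrow> \<nu> (x * y) = \<nu> x + \<nu> y) \<and>
     (\<forall>x y. x \<noteq> 0 \<longrightarrow> y \<noteq> 0 \<longrightarrow> x + y \<noteq> 0 \<longrightarrow> min (\<nu> x) (\<nu> y) \<le> \<nu> (x + y)) \<and>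
     \<nu> ` (UNIV - {0}) = UNIV"

definition val_ge :: "('k::field \<Rightarrow> int) \<Rightarrow> 'k \<Rightarrow> int \<Rightarrow> bool" where
  "val_ge \<nu> x n \<longleftrightarrow> x = 0 \<or> n \<le> \<nu> x"

definition valuation_ring :: "('k::field \<Rightarrow> int) \<Rightarrow> 'k set" where
  "valuation_ring \<nu> = {x. val_ge \<nu> x 0}"

definition center :: "'k::field set \<Rightarrow> ('k \<Rightarrow> int) \<Rightarrow> 'k set" where
  "center R \<nu> = {f \<in> R. val_ge \<nu> f 1}"

text \<open>
  The index set \<open>{1, \<dots>, r}\<close> is a nonempty finite linearly ordered type \<open>'r\<close>; its last element
  \<open>Max UNIV\<close> plays the role of \<open>r\<close>. Exponent vectors are functions \<open>'r \<Rightarrow> int\<close> with pointwise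
  operations, so \<open>1\<close> is the vector with all components \<open>1\<close>.
\<close>

definition exponent_vec :: "'r set \<Rightarrow> 'r \<Rightarrow> int" where
  "exponent_vec I = (\<lambda>j. if j \<in> I then 1 else 0)"

definition filtration :: "'k::field set \<Rightarrow> ('r \<Rightarrow> 'k \<Rightarrow> int) \<Rightarrow> ('r \<Rightarrow> int) \<Rightarrow> 'k set" where
  "filtration R \<nu> v = {g \<in> R. \<forall>j. val_ge (\<nu> j) g (v j)}"


section \<open>Quotients, direct sums and homology of modules\<close>

text \<open>The ring components \<open>mult\<close> and \<open>one\<close> of module records carry no information.\<close>

definition quotient_module :: "('a, 'b, 'm) module_scheme \<Rightarrow> 'b set \<Rightarrow> ('a, 'b set) module" where
  "quotient_module M N =
     \<lparr>carrier = a_rcosets\<^bsub>M\<^esub> N, mult = (\<lambda>X Y. N), one = N, zero = N,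
      add = (\<lambda>X Y. X <+>\<^bsub>M\<^esub> Y), smult = (\<lambda>c X. N <+>\<^bsub>M\<^esub> (\<lambda>x. c \<odot>\<^bsub>M\<^esub> x) ` X)\<rparr>"

text \<open>For a finite index set the direct sum is the direct product.\<close>

definition finite_direct_sum ::
    "'i set \<Rightarrow> ('i \<Rightarrow> ('a, 'b, 'm) module_scheme) \<Rightarrow> ('a, 'i \<Rightarrow> 'b) module" where
  "finite_direct_sum S V =
     \<lparr>carrier = (\<Pi>\<^sub>E i\<in>S. carrier (V i)), mult = (\<lambda>x y. \<lambda>i\<in>S. \<zero>\<^bsub>V i\<^esub>), one = (\<lambda>i\<in>S. \<zero>\<^bsub>V i\<^esub>),
      zero = (\<lambda>i\<in>S. \<zero>\<^bsub>V i\<^esub>), add = (\<lambda>x y. \<lambda>i\<in>S. x i \<oplus>\<^bsub>V i\<^esub> y i),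
      smult = (\<lambda>c x. \<lambda>i\<in>S. c \<odot>\<^bsub>V i\<^esub> x i)\<rparr>"

abbreviation dim\<^sub>C :: "(complex, 'b, 'm) module_scheme \<Rightarrow> nat" where
  "dim\<^sub>C V \<equiv> vectorspace.dim class_ring V"

abbreviation fin_dim\<^sub>C :: "(complex, 'b, 'm) module_scheme \<Rightarrow> bool" where
  "fin_dim\<^sub>C V \<equiv> vectorspace.fin_dim class_ring V"

definition field_module :: "(complex \<Rightarrow> 'k::field) \<Rightarrow> (complex, 'k) module" where
  "field_module \<iota> =
     \<lparr>carrier = UNIV, mult = (*), one = 1, zero = 0, add = (+), smult = (\<lambda>c x. \<iota> c * x)\<rparr>"

definition filtration_quotient ::
    "(complex \<Rightarrow> 'k::field) \<Rightarrow> 'k set \<Rightarrow> ('r \<Rightarrow> 'k \<Rightarrow> int) \<Rightarrow> ('r \<Rightarrow> int) \<Rightarrow> ('r \<Rightarrow> int) \<Rightarrow>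
     (complex, 'k set) module" where
  "filtration_quotient \<iota> R \<nu> v w =
     quotient_module ((field_module \<iota>)\<lparr>carrier := filtration R \<nu> v\<rparr>) (filtration R \<nu> w)"

abbreviation complex_summand ::
    "(complex \<Rightarrow> 'k::field) \<Rightarrow> 'k set \<Rightarrow> ('r \<Rightarrow> 'k \<Rightarrow> int) \<Rightarrow> ('r \<Rightarrow> int) \<Rightarrow> 'r set \<Rightarrow>
     (complex, 'k set) module" where
  "complex_summand \<iota> R \<nu> v I \<equiv> filtration_quotient \<iota> R \<nu> (v + exponent_vec I) (v + 1)"

text \<open>
  The degree \<open>i\<close> ranges over the integers; for \<open>i < 0\<close> and for \<open>i > CARD('r)\<close> the index set is
  empty and the chain space is zero.
\<close>

definition chain_space ::
    "(complex \<Rightarrow> 'k::field) \<Rightarrow> 'k set \<Rightarrow> ('r::finite \<Rightarrow> 'k \<Rightarrow> int) \<Rightarrow> ('r \<Rightarrow> int) \<Rightarrow> int \<Rightarrow>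
     (complex, 'r set \<Rightarrow> 'k set) module" where
  "chain_space \<iota> R \<nu> v i =
     finite_direct_sum {I. int (card I) = i} (complex_summand \<iota> R \<nu> v)"

text \<open>
  \<open>boundary \<dots> i\<close> goes from degree \<open>i\<close> to degree \<open>i - 1\<close>. The sets \<open>I\<close> whose summand contributes to
  the component at \<open>J\<close> are those of the form \<open>insert a J\<close> with \<open>a \<notin> J\<close>, and \<open>a\<close> is then the \<open>k\<close>-th
  smallest element of \<open>I\<close> for \<open>k = card {b \<in> I. b \<le> a}\<close>. The inclusion of the summand at \<open>I\<close> into
  the one at \<open>J\<close> is the identity on cosets of \<open>filtration R \<nu> (v + 1)\<close>.
\<close>

definition boundary ::
    "(complex \<Rightarrow> 'k::field) \<Rightarrow> 'k set \<Rightarrow> ('r::{finite,linorder} \<Rightarrow> 'k \<Rightarrow> int) \<Rightarrow> ('r \<Rightarrow> int) \<Rightarrow> int \<Rightarrow>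
     ('r set \<Rightarrow> 'k set) \<Rightarrow> 'r set \<Rightarrow> 'k set" where
  "boundary \<iota> R \<nu> v i x =
     (\<lambda>J\<in>{J. int (card J) = i - 1}.
        \<Oplus>\<^bsub>complex_summand \<iota> R \<nu> v J\<^esub>a\<in>- J.
          (- 1) ^ card {b \<in> insert a J. b \<le> a} \<odot>\<^bsub>complex_summand \<iota> R \<nu> v J\<^esub> x (insert a J))"

definition homology_space ::
    "(complex \<Rightarrow> 'k::field) \<Rightarrow> 'k set \<Rightarrow> ('r::{finite,linorder} \<Rightarrow> 'k \<Rightarrow> int) \<Rightarrow> ('r \<Rightarrow> int) \<Rightarrow> int \<Rightarrow>
     (complex, ('r set \<Rightarrow> 'k set) set) module" where
  "homology_space \<iota> R \<nu> v i =
     quotient_module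
       ((chain_space \<iota> R \<nu> v i)\<lparr>carrier :=
          a_kernel (chain_space \<iota> R \<nu> v i) (chain_space \<iota> R \<nu> v (i - 1)) (boundary \<iota> R \<nu> v i)\<rparr>)
       (boundary \<iota> R \<nu> v (i + 1) ` carrier (chain_space \<iota> R \<nu> v (i + 1)))"


section \<open>Series indexed by integer vectors\<close>

text \<open>
  A series is its coefficient function. Laurent polynomials, the elements of the library type
  \<open>('r \<Rightarrow> int) \<Rightarrow>\<^sub>0 int\<close>, act on series by multiplication.
\<close>

type_synonym 'r series = "('r \<Rightarrow> int) \<Rightarrow> int"

definition laurent_var :: "'r \<Rightarrow> ('r \<Rightarrow> int) \<Rightarrow>\<^sub>0 int" where
  "laurent_var j = Poly_Mapping.single (exponent_vec {j}) 1"

definition laurent_times :: "(('r \<Rightarrow> int) \<Rightarrow>\<^sub>0 int) \<Rightarrow> 'r series \<Rightarrow> 'r series" where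
  "laurent_times p F = (\<lambda>v. \<Sum>a\<in>Poly_Mapping.keys p. Poly_Mapping.lookup p a * F (v - a))"

definition is_power_series :: "'r series \<Rightarrow> bool" where
  "is_power_series F \<longleftrightarrow> (\<forall>v. F v \<noteq> 0 \<longrightarrow> (\<forall>j. 0 \<le> v j))"

text \<open>
  Division in the ring of formal power series. For the divisor used below the quotient exists and
  is unique, see \<open>power_series_div_unique\<close>.
\<close>

definition power_series_div :: "'r series \<Rightarrow> (('r \<Rightarrow> int) \<Rightarrow>\<^sub>0 int) \<Rightarrow> 'r series" where
  "power_series_div F p = (THE Q. is_power_series Q \<and> laurent_times p Q = F)"

lemma laurent_times_superset:
  assumes "finite B" "Poly_Mapping.keys p \<subseteq> B"
  shows "laurent_times p F v = (\<Sum>a\<in>B. Poly_Mapping.lookup p a * F (v - a))"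
  unfolding laurent_times_def
  by (rule sum.mono_neutral_left) (use assms in \<open>auto simp: in_keys_iff\<close>)

lemma prod_laurent_var:
  "(\<Prod>j\<in>UNIV. laurent_var j) = Poly_Mapping.single (1 :: 'r::finite \<Rightarrow> int) 1"
proof -
  have "(\<Prod>j\<in>I. laurent_var j) = Poly_Mapping.single (exponent_vec I) 1" for I :: "'r set"
  proof (induction I rule: finite_induct[OF finite])
    case 1
    then show ?case by (simp add: exponent_vec_def zero_fun_def flip: single_one)
  next
    case (2 a I)
    have "exponent_vec {a} + exponent_vec I = exponent_vec (insert a I)"
      using 2 by (auto simp: exponent_vec_def fun_eq_iff)
    then show ?case using 2 by (simp add: laurent_var_def mult_single)
  qed
  from this[of UNIV] show ?thesis by (simp add: exponent_vec_def one_fun_def)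
qed

lemma laurent_times_divisor:
  fixes Q :: "'r::finite series"
  shows "laurent_times ((\<Prod>j\<in>UNIV. laurent_var j) - 1) Q v = Q (v - 1) - Q v"
proof -
  let ?p = "Poly_Mapping.single (1 :: 'r \<Rightarrow> int) 1 - 1 :: ('r \<Rightarrow> int) \<Rightarrow>\<^sub>0 int"
  have l: "Poly_Mapping.lookup ?p a = (if a = 1 then 1 else 0) - (if a = 0 then 1 else 0)" for a
    by (auto simp: lookup_minus lookup_single lookup_one when_def)
  have ne: "(1 :: 'r \<Rightarrow> int) \<noteq> 0"
    by (simp add: fun_eq_iff)
  have "Poly_Mapping.keys ?p \<subseteq> {1, 0}"
    by (auto simp: in_keys_iff l split: if_splits)
  from laurent_times_superset[OF _ this] show ?thesis
    unfolding prod_laurent_var using ne by (simp add: l)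
qed

lemma power_series_div_unique:
  fixes F :: "'r::finite series"
  assumes F: "is_power_series F"
  shows "\<exists>!Q. is_power_series Q \<and> laurent_times ((\<Prod>j\<in>UNIV. laurent_var j) - 1) Q = F"
proof -
  define m where "m v = Min (range v)" for v :: "'r \<Rightarrow> int"
  have m_le: "c \<le> m v \<longleftrightarrow> (\<forall>j. c \<le> v j)" for c v
    by (auto simp: m_def)
  have m_lower: "m v \<le> v j" for v j
    using m_le by blast
  have m1: "m (v - 1) = m v - 1" for v
  proof (rule antisym)
    have "m (v - 1) + 1 \<le> v j" for j
      using m_lower[of "v - 1" j] by simp
    then show "m (v - 1) \<le> m v - 1"
      using m_le[of "m (v - 1) + 1" v] by simp
    have "m v - 1 \<le> (v - 1) j" for j
      using m_lower[of v j] by simp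
    then show "m v - 1 \<le> m (v - 1)"
      using m_le by blast
  qed
  show ?thesis
  proof (rule ex_ex1I)
  define Q where "Q v = (if m v < 0 then 0 else - (\<Sum>k\<le>nat (m v). F (v - (\<lambda>_. int k))))" for v
  have "is_power_series Q"
    unfolding is_power_series_def Q_def using m_le[of 0] by (auto simp: not_less split: if_splits)
  moreover have "Q (v - 1) - Q v = F v" for v
  proof -
    consider "m v < 0" | "m v = 0" | "0 < m v" by linarith
    then show ?thesis
    proof cases
      case 1
      then have "F v = 0" using F m_le[of 0 v] unfolding is_power_series_def by fastforce
      then show ?thesis using 1 by (simp add: Q_def m1)
    next
      case 2
      then show ?thesis by (simp add: Q_def m1 flip: zero_fun_def)
    next
      case 3
      define n where "n = nat (m v - 1)"
      have "(\<Sum>k\<le>n. F (v - 1 - (\<lambda>_. int k))) = (\<Sum>k\<le>n. F (v - (\<lambda>_. int (Suc k))))"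
        by (intro sum.cong refl arg_cong[of _ _ F]) (simp add: fun_eq_iff)
      moreover have "nat (m v) = Suc n" "nat (m (v - 1)) = n" using 3 by (auto simp: m1 n_def)
      ultimately show ?thesis using 3
        by (simp add: Q_def m1 sum.atMost_Suc_shift flip: zero_fun_def del: sum.atMost_Suc of_nat_Suc)
    qed
  qed
  ultimately show "\<exists>Q. is_power_series Q \<and> laurent_times ((\<Prod>j\<in>UNIV. laurent_var j) - 1) Q = F"
    by (auto simp: laurent_times_divisor fun_eq_iff)
  fix P Q :: "'r series"
  assume "is_power_series P \<and> laurent_times ((\<Prod>j\<in>UNIV. laurent_var j) - 1) P = F"
    and "is_power_series Q \<and> laurent_times ((\<Prod>j\<in>UNIV. laurent_var j) - 1) Q = F"
  then have P: "is_power_series P" "P (v - 1) - P v = F v"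
    and Q: "is_power_series Q" "Q (v - 1) - Q v = F v" for v
    by (auto simp flip: laurent_times_divisor)
  have "P v = Q v" if "m v < int n" for v n
    using that
  proof (induction n arbitrary: v)
    case 0
    then have "P v = 0" "Q v = 0" using P(1) Q(1) m_le[of 0 v]
      unfolding is_power_series_def by fastforce+
    then show ?case by simp
  next
    case (Suc n)
    have "m (v - 1) < int n"
      using Suc.prems m1[of v] by linarith
    then have "P (v - 1) = Q (v - 1)"
      by (rule Suc.IH)
    then show ?case using P(2)[of v] Q(2)[of v] by simp
  qed
  moreover have "m v < int (nat (m v + 1))" for v
    by linarith
  ultimately show "P = Q"
    by blast
  qed
qed

definition homology_series ::
    "(complex \<Rightarrow> 'k::field) \<Rightarrow> 'k set \<Rightarrow> ('r::{finite,linorder} \<Rightarrow> 'k \<Rightarrow> int) \<Rightarrow> 'r series" where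
  "homology_series \<iota> R \<nu> =
     (\<lambda>v. \<Sum>i<CARD('r). (- 1) ^ i * int (dim\<^sub>C (homology_space \<iota> R \<nu> v (int i))))"

definition poincare_series ::
    "(complex \<Rightarrow> 'k::field) \<Rightarrow> 'k set \<Rightarrow> ('r::{finite,linorder} \<Rightarrow> 'k \<Rightarrow> int) \<Rightarrow> 'r series" where
  "poincare_series \<iota> R \<nu> =
     (\<lambda>v. \<Sum>K\<in>Pow (- {Max UNIV}). (- 1) ^ card K *
        int (dim\<^sub>C (filtration_quotient \<iota> R \<nu> (v + exponent_vec K)
                                      (v + exponent_vec K + exponent_vec {Max UNIV}))))"

definition hilbert_series ::
    "(complex \<Rightarrow> 'k::field) \<Rightarrow> 'k set \<Rightarrow> ('r \<Rightarrow> 'k \<Rightarrow> int) \<Rightarrow> 'r series" where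
  "hilbert_series \<iota> R \<nu> = (\<lambda>v. int (dim\<^sub>C (filtration_quotient \<iota> R \<nu> v (v + 1))))"

definition classical_numerator ::
    "(complex \<Rightarrow> 'k::field) \<Rightarrow> 'k set \<Rightarrow> ('r::finite \<Rightarrow> 'k \<Rightarrow> int) \<Rightarrow> 'r series" where
  "classical_numerator \<iota> R \<nu> =
     laurent_times (\<Prod>j\<in>UNIV. laurent_var j - 1) (hilbert_series \<iota> R \<nu>)"

definition classical_poincare_series ::
    "(complex \<Rightarrow> 'k::field) \<Rightarrow> 'k set \<Rightarrow> ('r::finite \<Rightarrow> 'k \<Rightarrow> int) \<Rightarrow> 'r series" where
  "classical_poincare_series \<iota> R \<nu> =
     power_series_div (classical_numerator \<iota> R \<nu>) ((\<Prod>j\<in>UNIV. laurent_var j) - 1)"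

end

theory Submission
  imports Defs
begin

text \<open>
  The complex of the \<open>V_I\<close> splits according to whether the last index \<open>r\<close> belongs to \<open>I\<close>. The
  summands with \<open>r\<close> in \<open>I\<close> form a copy, shifted by one degree, of the complex of the spaces
  \<open>V_(K \<union> r)\<close> with \<open>K\<close> not containing \<open>r\<close>, and the component of the boundary from that copy to
  the summands without \<open>r\<close> is the inclusion of \<open>V_(K \<union> r)\<close> into \<open>V_K\<close>. So the whole complex is
  a mapping cone of an injective map, and its homology is that of the quotient complex with terms
  \<open>V_K / V_(K \<union> r) = M(v + e_K) / M(v + e_K + e_r)\<close>. The cone contraction of the subcomplex that is
  divided out is \<open>contraction\<close>, with \<open>contraction_homotopy\<close> as its key identity;
  \<open>homology_iso\<close> draws the conclusion.

  The terms of the quotient complex are finite-dimensional because \<open>\<nu>_r\<close> is centered at the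
  maximal ideal \<open>m\<close>: then \<open>\<nu>_r\<close> is at least \<open>n\<close> on \<open>m^n\<close>, so the functions with
  \<open>\<nu>_r \<ge> n\<close> have finite codimension in the local ring, and the quotient
  \<open>M(v) / M(v + e_r)\<close> embeds into a quotient by such a space (\<open>fin_codim_final\<close>). The
  Euler characteristic of a finite-dimensional complex can be computed from its terms instead of
  its homology, and this is the equality of the homology series with the first Poincare series
  (\<open>homology_euler_characteristic\<close>).

  For the classical series, let \<open>P\<close> be the first Poincare series. The asserted quotient is
  characterized by being a power series \<open>P\<close> with \<open>P(v - 1) - P(v)\<close> equal to the coefficient of the
  numerator. Measuring all spaces between \<open>M(v - 1)\<close> and \<open>M(v + 1)\<close> by their codimension \<open>L\<close> in
  \<open>M(v - 1)\<close>, both sides become alternating sums of values of \<open>L\<close>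
  (\<open>classical_numerator_eq\<close>). The coefficients of \<open>P\<close> at exponents with a negative component
  vanish since a condition \<open>\<nu>_j \<ge> n\<close> with \<open>n \<le> 0\<close> is void on the local ring.

  The vector spaces in question are iterated quotients, direct sums and subspaces, with cosets of
  cosets as elements. All of them are described by a linear surjection from a subspace
  \<open>U\<close> of a fixed ambient space whose kernel is a subspace \<open>W\<close>
  (\<open>quotient_presentation\<close>). Dimensions are then computed as relative dimensions of pairs
  \<open>W \<subseteq> U\<close>, which are additive along chains and invariant under linear maps.
\<close>

section \<open>Subquotients of a vector space\<close>

text \<open>
  The space \<open>V\<close> is \<open>U / W\<close> up to the isomorphism induced by the surjection \<open>\<pi>\<close>. It inherits
  the vector space axioms from \<open>U\<close>, so a presentation of a quotient module is obtained by
  computing with its operations alone.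
\<close>

locale quotient_presentation = vector_space scale
  for scale :: "'a::field \<Rightarrow> 'b::ab_group_add \<Rightarrow> 'b" (infixr "*s" 75) +
  fixes U W :: "'b set" and V :: "('a, 'c, 'm) module_scheme" and \<pi> :: "'b \<Rightarrow> 'c"
  assumes subspace_U: "subspace U" and subspace_W: "subspace W" and W_sub_U: "W \<subseteq> U"
    and carrier: "carrier V = \<pi> ` U"
    and add: "\<And>x y. x \<in> U \<Longrightarrow> y \<in> U \<Longrightarrow> \<pi> (x + y) = \<pi> x \<oplus>\<^bsub>V\<^esub> \<pi> y"
    and smult: "\<And>c x. x \<in> U \<Longrightarrow> \<pi> (c *s x) = c \<odot>\<^bsub>V\<^esub> \<pi> x"
    and kernel: "\<And>x. x \<in> U \<Longrightarrow> \<pi> x = \<zero>\<^bsub>V\<^esub> \<longleftrightarrow> x \<in> W"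
begin

lemma zero: "\<pi> 0 = \<zero>\<^bsub>V\<^esub>"
  using kernel[of 0] subspace_U subspace_W by (simp add: subspace_0)

lemma vectorspace: "vectorspace class_ring V"
proof (rule vs_criteria)
  note U = subspace_0[OF subspace_U] subspace_add[OF subspace_U] subspace_scale[OF subspace_U]
  show "\<zero>\<^bsub>V\<^esub> \<in> carrier V"
    using U(1) zero by (metis carrier imageI)
  show "\<forall>v\<in>carrier V. \<exists>w\<in>carrier V. v \<oplus>\<^bsub>V\<^esub> w = \<zero>\<^bsub>V\<^esub>"
  proof
    fix v assume "v \<in> carrier V"
    then obtain x where x: "x \<in> U" "v = \<pi> x" by (auto simp: carrier)
    have mx: "- x \<in> U" using x subspace_neg[OF subspace_U] by blast
    have "v \<oplus>\<^bsub>V\<^esub> \<pi> (- x) = \<zero>\<^bsub>V\<^esub>"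
      using add[OF x(1) mx] x zero by simp
    then show "\<exists>w\<in>carrier V. v \<oplus>\<^bsub>V\<^esub> w = \<zero>\<^bsub>V\<^esub>"
      using mx by (auto simp: carrier)
  qed
qed (auto simp: carrier add[symmetric] smult[symmetric] zero[symmetric] class_field
    subspace_0[OF subspace_U] subspace_add[OF subspace_U] subspace_scale[OF subspace_U]
    add_ac scale_left_distrib scale_right_distrib)

lemma eq_iff:
  assumes "x \<in> U" "y \<in> U"
  shows "\<pi> x = \<pi> y \<longleftrightarrow> x - y \<in> W"
proof -
  interpret V: vectorspace class_ring V by (rule vectorspace)
  have d: "x - y \<in> U" using assms subspace_U by (rule subspace_diff[rotated])
  have "\<pi> x = \<pi> (x - y) \<oplus>\<^bsub>V\<^esub> \<pi> y" using add[OF d assms(2)] by simp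
  moreover have "\<pi> x \<in> carrier V" "\<pi> y \<in> carrier V" "\<pi> (x - y) \<in> carrier V"
    using assms d by (auto simp: carrier)
  ultimately have "\<pi> x = \<pi> y \<longleftrightarrow> \<pi> (x - y) = \<zero>\<^bsub>V\<^esub>"
    using V.M.add.r_cancel_one V.M.zero_closed by (metis V.M.add.r_cancel_one')
  with kernel[OF d] show ?thesis by simp
qed

lemma finsum:
  assumes "finite A" "\<And>a. a \<in> A \<Longrightarrow> f a \<in> U"
  shows "\<pi> (\<Sum>a\<in>A. f a) = (\<Oplus>\<^bsub>V\<^esub>a\<in>A. \<pi> (f a))"
  using assms
proof (induction A rule: finite_induct)
  interpret V: vectorspace class_ring V by (rule vectorspace)
  case empty
  then show ?case by (simp add: zero)
next
  interpret V: vectorspace class_ring V by (rule vectorspace)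
  case (insert a A)
  then have "(\<lambda>a. \<pi> (f a)) \<in> A \<rightarrow> carrier V" "\<pi> (f a) \<in> carrier V" by (auto simp: carrier)
  with insert show ?case
    by (simp add: add subspace_sum[OF subspace_U])
qed

text \<open>
  The image of an intermediate space \<open>X\<close> presents \<open>X / W\<close>; this handles the kernels.
\<close>

lemma restrict:
  assumes "subspace X" "W \<subseteq> X" "X \<subseteq> U"
  shows "quotient_presentation scale X W (V\<lparr>carrier := \<pi> ` X\<rparr>) \<pi>"
  by unfold_locales (use assms subspace_W add smult kernel in \<open>auto simp: subset_iff\<close>)

lemma coset_eq: "x \<in> U \<Longrightarrow> X \<subseteq> U \<Longrightarrow> \<pi> ` X +>\<^bsub>V\<^esub> \<pi> x = (\<lambda>z. \<pi> (z + x)) ` X"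
  by (auto simp: a_r_coset_def' add subset_iff)

text \<open>
  Isomorphism theorem \<open>(U / W) / (X / W) = U / X\<close>: dividing a presented space by the image of \<open>X\<close>
  only enlarges the kernel of the presentation.
\<close>

lemma quotient:
  assumes X: "subspace X" "W \<subseteq> X" "X \<subseteq> U"
  shows "quotient_presentation scale U X (quotient_module V (\<pi> ` X)) (\<lambda>x. \<pi> ` X +>\<^bsub>V\<^esub> \<pi> x)"
proof unfold_locales
  show "carrier (quotient_module V (\<pi> ` X)) = (\<lambda>x. \<pi> ` X +>\<^bsub>V\<^esub> \<pi> x) ` U"
    by (auto simp: quotient_module_def A_RCOSETS_def RCOSETS_def carrier a_r_coset_def)
next
  fix x y assume xy: "x \<in> U" "y \<in> U"
  then have "x + y \<in> U" using subspace_U subspace_add by blast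
  have "(\<pi> ` X +>\<^bsub>V\<^esub> \<pi> x) \<oplus>\<^bsub>quotient_module V (\<pi> ` X)\<^esub> (\<pi> ` X +>\<^bsub>V\<^esub> \<pi> y)
      = (\<Union>z\<in>X. \<Union>z'\<in>X. {\<pi> (z + x) \<oplus>\<^bsub>V\<^esub> \<pi> (z' + y)})"
    using xy X by (simp add: coset_eq quotient_module_def set_add_def')
  also have "\<dots> = (\<Union>z\<in>X. \<Union>z'\<in>X. {\<pi> ((z + z') + (x + y))})"
    using xy X by (intro SUP_cong refl)
      (simp add: add[symmetric] subset_iff subspace_add[OF subspace_U] add_ac)
  also have "\<dots> = (\<lambda>z. \<pi> (z + (x + y))) ` X"
  proof (intro subset_antisym subsetI)
    fix w assume "w \<in> (\<lambda>z. \<pi> (z + (x + y))) ` X"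
    then obtain z where "z \<in> X" "w = \<pi> ((z + 0) + (x + y))" by auto
    with subspace_0[OF X(1)] show "w \<in> (\<Union>z\<in>X. \<Union>z'\<in>X. {\<pi> ((z + z') + (x + y))})" by blast
  qed (use subspace_add[OF X(1)] in blast)
  also have "\<dots> = \<pi> ` X +>\<^bsub>V\<^esub> \<pi> (x + y)"
    using \<open>x + y \<in> U\<close> X by (simp add: coset_eq)
  finally show "\<pi> ` X +>\<^bsub>V\<^esub> \<pi> (x + y) =
      (\<pi> ` X +>\<^bsub>V\<^esub> \<pi> x) \<oplus>\<^bsub>quotient_module V (\<pi> ` X)\<^esub> (\<pi> ` X +>\<^bsub>V\<^esub> \<pi> y)" by simp
next
  fix c x assume x: "x \<in> U"
  then have cx: "c *s x \<in> U" using subspace_U subspace_scale by blast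
  have "c \<odot>\<^bsub>quotient_module V (\<pi> ` X)\<^esub> (\<pi> ` X +>\<^bsub>V\<^esub> \<pi> x)
      = (\<Union>z\<in>X. \<Union>z'\<in>X. {\<pi> z \<oplus>\<^bsub>V\<^esub> c \<odot>\<^bsub>V\<^esub> \<pi> (z' + x)})"
    using x X by (simp add: coset_eq quotient_module_def set_add_def')
  also have "\<dots> = (\<Union>z\<in>X. \<Union>z'\<in>X. {\<pi> ((z + c *s z') + c *s x)})"
    using x X by (intro SUP_cong refl)
      (simp add: add[symmetric] smult[symmetric] subset_iff subspace_add[OF subspace_U]
        subspace_scale[OF subspace_U] add_ac scale_right_distrib)
  also have "\<dots> = (\<lambda>z. \<pi> (z + c *s x)) ` X"
  proof (intro subset_antisym subsetI)
    fix w assume "w \<in> (\<lambda>z. \<pi> (z + c *s x)) ` X"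
    then obtain z where "z \<in> X" "w = \<pi> ((z + c *s 0) + c *s x)" by auto
    with subspace_0[OF X(1)] show "w \<in> (\<Union>z\<in>X. \<Union>z'\<in>X. {\<pi> ((z + c *s z') + c *s x)})" by blast
  qed (use subspace_add[OF X(1)] subspace_scale[OF X(1)] in blast)
  also have "\<dots> = \<pi> ` X +>\<^bsub>V\<^esub> \<pi> (c *s x)"
    using cx X by (simp add: coset_eq)
  finally show "\<pi> ` X +>\<^bsub>V\<^esub> \<pi> (c *s x) = c \<odot>\<^bsub>quotient_module V (\<pi> ` X)\<^esub> (\<pi> ` X +>\<^bsub>V\<^esub> \<pi> x)"
    by simp
next
  fix x assume x: "x \<in> U"
  have "(\<lambda>z. \<pi> (z + x)) ` X = \<pi> ` X \<longleftrightarrow> x \<in> X"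
  proof
    assume "(\<lambda>z. \<pi> (z + x)) ` X = \<pi> ` X"
    moreover have "\<pi> (0 + x) \<in> (\<lambda>z. \<pi> (z + x)) ` X" using subspace_0[OF X(1)] by blast
    ultimately obtain z where z: "z \<in> X" "\<pi> x = \<pi> z" by auto
    then have "x - z \<in> X" using eq_iff[of x z] x X by blast
    then show "x \<in> X" using subspace_add[OF X(1) _ z(1)] by fastforce
  next
    assume "x \<in> X"
    then have "z - x \<in> X" "z + x \<in> X" if "z \<in> X" for z
      using that subspace_diff[OF X(1)] subspace_add[OF X(1)] by auto
    then show "(\<lambda>z. \<pi> (z + x)) ` X = \<pi> ` X"
      by (force simp: image_iff intro: bexI[of _ "_ - x"])
  qed
  then show "\<pi> ` X +>\<^bsub>V\<^esub> \<pi> x = \<zero>\<^bsub>quotient_module V (\<pi> ` X)\<^esub> \<longleftrightarrow> x \<in> X"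
    using x X by (simp add: coset_eq quotient_module_def)
qed (use X subspace_U in auto)

end

definition ambient_module :: "('a::field \<Rightarrow> 'b::ab_group_add \<Rightarrow> 'b) \<Rightarrow> 'b set \<Rightarrow> ('a, 'b) module" where
  "ambient_module scale U =
     \<lparr>carrier = U, mult = (\<lambda>x y. 0), one = 0, zero = 0, add = (+), smult = scale\<rparr>"

text \<open>
  A standard model of \<open>U / W\<close>, through which relative dimensions are defined.
\<close>

definition subquotient :: "('a::field \<Rightarrow> 'b::ab_group_add \<Rightarrow> 'b) \<Rightarrow> 'b set \<Rightarrow> 'b set \<Rightarrow> ('a, 'b set) module" where
  "subquotient scale U W = quotient_module (ambient_module scale U) W"

definition fin_codim :: "('a::field \<Rightarrow> 'b::ab_group_add \<Rightarrow> 'b) \<Rightarrow> 'b set \<Rightarrow> 'b set \<Rightarrow> bool" where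
  "fin_codim scale U W \<longleftrightarrow> vectorspace.fin_dim class_ring (subquotient scale U W)"

definition codim :: "('a::field \<Rightarrow> 'b::ab_group_add \<Rightarrow> 'b) \<Rightarrow> 'b set \<Rightarrow> 'b set \<Rightarrow> nat" where
  "codim scale U W = vectorspace.dim class_ring (subquotient scale U W)"

text \<open>
  Every vector space is an instance. The separate name keeps the facts below from being
  copied into the interpretations of \<open>vector_space\<close> for real vector spaces.
\<close>

locale relative_dimension = vector_space scale
  for scale :: "'a::field \<Rightarrow> 'b::ab_group_add \<Rightarrow> 'b" (infixr "*s" 75)
begin

lemma ambient_presentation:
  "subspace U \<Longrightarrow> quotient_presentation scale U {0} (ambient_module scale U) id"
  by unfold_locales (auto simp: ambient_module_def subspace_0)

lemma subquotient_presentation: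
  assumes "subspace U" "subspace W" "W \<subseteq> U"
  shows "quotient_presentation scale U W (subquotient scale U W) (\<lambda>x. (\<lambda>z. z + x) ` W)"
proof -
  interpret quotient_presentation scale U "{0}" "ambient_module scale U" id
    by (rule ambient_presentation[OF assms(1)])
  have "W +>\<^bsub>ambient_module scale U\<^esub> x = (\<lambda>z. z + x) ` W" for x
    by (auto simp: a_r_coset_def' ambient_module_def)
  with quotient[OF assms(2) _ assms(3)] assms(2) show ?thesis
    by (simp add: subquotient_def subspace_0)
qed

end

section \<open>Linear maps between subquotients\<close>

text \<open>
  Maps between presented spaces are given by linear maps of the ambient spaces; they only have to be
  defined on \<open>U\<close> and to respect the kernels.
\<close>

lemma induced_map:
  fixes s :: "'a::field \<Rightarrow> 'b::ab_group_add \<Rightarrow> 'b" and s' :: "'a \<Rightarrow> 'd::ab_group_add \<Rightarrow> 'd"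
  assumes "quotient_presentation s U W V \<pi>" "quotient_presentation s' U' W' V' \<pi>'"
    and f: "\<And>x. x \<in> U \<Longrightarrow> f x \<in> U'" "\<And>x. x \<in> W \<Longrightarrow> f x \<in> W'"
    and f_add: "\<And>x y. x \<in> U \<Longrightarrow> y \<in> U \<Longrightarrow> f (x + y) = f x + f y"
    and f_scale: "\<And>c x. x \<in> U \<Longrightarrow> f (s c x) = s' c (f x)"
  obtains T where "linear_map class_ring V V' T" "\<And>x. x \<in> U \<Longrightarrow> T (\<pi> x) = \<pi>' (f x)"
proof -
  interpret P: quotient_presentation s U W V \<pi> by fact
  interpret P': quotient_presentation s' U' W' V' \<pi>' by fact
  interpret V: vectorspace class_ring V by (rule P.vectorspace)
  interpret V': vectorspace class_ring V' by (rule P'.vectorspace)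
  note U = P.subspace_add[OF P.subspace_U] P.subspace_diff[OF P.subspace_U]
    P.subspace_scale[OF P.subspace_U]
  define T where "T v = \<pi>' (f (SOME x. x \<in> U \<and> \<pi> x = v))" for v
  have T: "T (\<pi> x) = \<pi>' (f x)" if x: "x \<in> U" for x
  proof -
    define y where "y = (SOME y. y \<in> U \<and> \<pi> y = \<pi> x)"
    have y: "y \<in> U" "\<pi> y = \<pi> x"
      using someI[of "\<lambda>y. y \<in> U \<and> \<pi> y = \<pi> x" x] x by (auto simp: y_def)
    then have "y - x \<in> W" using P.eq_iff x by blast
    moreover have "f y = f (y - x) + f x" using f_add[OF U(2)[OF y(1) x] x] by simp
    ultimately have "f y - f x \<in> W'" using f(2) by simp
    then have "\<pi>' (f y) = \<pi>' (f x)" using P'.eq_iff f(1) x y(1) by blast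
    then show ?thesis by (simp add: T_def y_def)
  qed
  have "T \<in> LinearCombinations.module_hom class_ring V V'"
    unfolding LinearCombinations.module_hom_def mem_Collect_eq
  proof (intro conjI allI impI)
    show "T \<in> carrier V \<rightarrow> carrier V'"
      by (auto simp: P.carrier P'.carrier T f)
    fix v w assume "v \<in> carrier V \<and> w \<in> carrier V"
    then obtain x y where xy: "x \<in> U" "v = \<pi> x" "y \<in> U" "w = \<pi> y"
      by (auto simp: P.carrier)
    then have "T (\<pi> (x + y)) = \<pi>' (f x + f y)"
      by (simp add: T U f_add)
    with xy show "T (v \<oplus>\<^bsub>V\<^esub> w) = T v \<oplus>\<^bsub>V'\<^esub> T w"
      by (simp add: P.add P'.add T f)
  next
    fix c :: 'a and v assume "c \<in> carrier class_ring \<and> v \<in> carrier V"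
    then obtain x where x: "x \<in> U" "v = \<pi> x"
      by (auto simp: P.carrier)
    then have "T (\<pi> (s c x)) = \<pi>' (s' c (f x))"
      by (simp add: T U f_scale)
    with x show "T (c \<odot>\<^bsub>V\<^esub> v) = c \<odot>\<^bsub>V'\<^esub> T v"
      by (simp add: P.smult P'.smult T f)
  qed
  then have "linear_map class_ring V V' T"
    by unfold_locales
  with T that show thesis by blast
qed

lemma (in linear_map) bijective_fin_dim_iff:
  assumes "bij_betw T (carrier V) (carrier W)"
  shows "V.fin_dim \<longleftrightarrow> W.fin_dim"
proof
  have surj: "T ` carrier V = carrier W" and inj: "inj_on T (carrier V)"
    using assms by (auto simp: bij_betw_def)
  show "W.fin_dim" if "V.fin_dim" using surj_fin_dim[OF that surj] .
  let ?S = "inv_into (carrier V) T"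
  have S: "?S w \<in> carrier V" "T (?S w) = w" if "w \<in> carrier W" for w
    using that surj by (auto simp: inv_into_into f_inv_into_f)
  have eqI: "x = y" if "x \<in> carrier V" "y \<in> carrier V" "T x = T y" for x y
    using that inj by (simp add: inj_on_eq_iff)
  have "?S \<in> LinearCombinations.module_hom K W V"
    unfolding LinearCombinations.module_hom_def mem_Collect_eq
  proof (intro conjI allI impI)
    show "?S \<in> carrier W \<rightarrow> carrier V" using S by blast
  next
    fix v w assume "v \<in> carrier W \<and> w \<in> carrier W"
    then show "?S (v \<oplus>\<^bsub>W\<^esub> w) = ?S v \<oplus>\<^bsub>V\<^esub> ?S w" by (intro eqI) (simp_all add: S)
  next
    fix c w assume "c \<in> carrier K \<and> w \<in> carrier W"
    then show "?S (c \<odot>\<^bsub>W\<^esub> w) = c \<odot>\<^bsub>V\<^esub> ?S w" by (intro eqI) (simp_all add: S)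
  qed
  then interpret S: linear_map K W V ?S by unfold_locales
  show "V.fin_dim" if "W.fin_dim"
    using S.surj_fin_dim[OF that] bij_betw_inv_into[OF assms] by (simp add: bij_betw_def)
qed

text \<open>
  The induced map is injective when \<open>W\<close> is the full preimage of \<open>W'\<close>, and surjective when
  \<open>f\<close> reaches every class modulo \<open>W'\<close>.
\<close>

lemma induced_isomorphism:
  fixes s :: "'a::field \<Rightarrow> 'b::ab_group_add \<Rightarrow> 'b" and s' :: "'a \<Rightarrow> 'd::ab_group_add \<Rightarrow> 'd"
  assumes P: "quotient_presentation s U W V \<pi>" "quotient_presentation s' U' W' V' \<pi>'"
    and f: "\<And>x. x \<in> U \<Longrightarrow> f x \<in> U'" "\<And>x. x \<in> U \<Longrightarrow> f x \<in> W' \<longleftrightarrow> x \<in> W"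
    and surj: "\<And>y. y \<in> U' \<Longrightarrow> \<exists>x\<in>U. y - f x \<in> W'"
    and f_add: "\<And>x y. x \<in> U \<Longrightarrow> y \<in> U \<Longrightarrow> f (x + y) = f x + f y"
    and f_scale: "\<And>c x. x \<in> U \<Longrightarrow> f (s c x) = s' c (f x)"
  shows "vectorspace.fin_dim class_ring V \<longleftrightarrow> vectorspace.fin_dim class_ring V'" (is ?fin)
    and "vectorspace.fin_dim class_ring V \<Longrightarrow>
      vectorspace.dim class_ring V = vectorspace.dim class_ring V'"
proof -
  interpret P: quotient_presentation s U W V \<pi> by fact
  interpret P': quotient_presentation s' U' W' V' \<pi>' by fact
  have fW: "f x \<in> W'" if "x \<in> W" for x
    using that f(2) P.W_sub_U by blast
  obtain T where T: "linear_map class_ring V V' T" "\<And>x. x \<in> U \<Longrightarrow> T (\<pi> x) = \<pi>' (f x)"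
    using induced_map[where f = f, OF P f(1) fW f_add f_scale] by metis
  interpret T: linear_map class_ring V V' T by fact
  have "T ` carrier V = carrier V'"
  proof -
    have "\<pi>' y \<in> T ` carrier V" if y: "y \<in> U'" for y
    proof -
      obtain x where "x \<in> U" "y - f x \<in> W'" using surj y by blast
      then have "\<pi>' y = T (\<pi> x)" using P'.eq_iff f(1) y T(2) by simp
      with \<open>x \<in> U\<close> show ?thesis by (auto simp: P.carrier)
    qed
    then show ?thesis by (auto simp: P'.carrier P.carrier T(2) f(1))
  qed
  moreover have "inj_on T (carrier V)"
  proof (rule inj_onI)
    fix v w assume "v \<in> carrier V" "w \<in> carrier V" and eq: "T v = T w"
    then obtain x y where xy: "x \<in> U" "v = \<pi> x" "y \<in> U" "w = \<pi> y"
      by (auto simp: P.carrier)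
    then have d: "x - y \<in> U" using P.subspace_diff[OF P.subspace_U] by blast
    have "f x = f (x - y) + f y" using f_add[OF d xy(3)] by simp
    moreover have "f x - f y \<in> W'" using eq xy T(2) P'.eq_iff f(1) by simp
    ultimately show "v = w" using f(2)[OF d] xy P.eq_iff by simp
  qed
  ultimately have bij: "bij_betw T (carrier V) (carrier V')" by (simp add: bij_betw_def)
  show ?fin by (rule T.bijective_fin_dim_iff[OF bij])
  show "vectorspace.fin_dim class_ring V \<Longrightarrow>
      vectorspace.dim class_ring V = vectorspace.dim class_ring V'"
    using T.dim_eq bij by (auto simp: bij_betw_def)
qed

lemma presentation_dim:
  assumes "quotient_presentation s U W V \<pi>"
  shows presentation_fin_dim_iff: "vectorspace.fin_dim class_ring V \<longleftrightarrow> fin_codim s U W"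
    and presentation_dim_eq: "fin_codim s U W \<Longrightarrow> vectorspace.dim class_ring V = codim s U W"
proof -
  interpret quotient_presentation s U W V \<pi> by fact
  interpret relative_dimension s by unfold_locales
  note Q = subquotient_presentation[OF subspace_U subspace_W W_sub_U]
  have "\<exists>x\<in>U. y - x \<in> W" if "y \<in> U" for y
    using that subspace_0[OF subspace_W] by (intro bexI[of _ y]) auto
  note I = induced_isomorphism[where f = "\<lambda>x. x", OF assms Q _ _ this]
  show "vectorspace.fin_dim class_ring V \<longleftrightarrow> fin_codim s U W"
    using I(1) by (simp add: fin_codim_def)
  show "fin_codim s U W \<Longrightarrow> vectorspace.dim class_ring V = codim s U W"
    using I by (simp add: fin_codim_def codim_def)
qed

text \<open>
  This one criterion covers the second isomorphism theorem (with \<open>f\<close> the identity), the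
  isomorphism from a coimage to an image (with \<open>f\<close> the boundary map), and the projections of
  direct sums.
\<close>

lemma codim_iso:
  fixes s :: "'a::field \<Rightarrow> 'b::ab_group_add \<Rightarrow> 'b" and s' :: "'a \<Rightarrow> 'd::ab_group_add \<Rightarrow> 'd"
  assumes "relative_dimension s" "relative_dimension s'"
    and "module.subspace s U" "module.subspace s W" "W \<subseteq> U"
    and "module.subspace s' U'" "module.subspace s' W'" "W' \<subseteq> U'"
    and f: "\<And>x. x \<in> U \<Longrightarrow> f x \<in> U'" "\<And>x. x \<in> U \<Longrightarrow> f x \<in> W' \<longleftrightarrow> x \<in> W"
    and surj: "\<And>y. y \<in> U' \<Longrightarrow> \<exists>x\<in>U. y - f x \<in> W'"
    and f_add: "\<And>x y. x \<in> U \<Longrightarrow> y \<in> U \<Longrightarrow> f (x + y) = f x + f y"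
    and f_scale: "\<And>c x. x \<in> U \<Longrightarrow> f (s c x) = s' c (f x)"
  shows fin_codim_iso: "fin_codim s U W \<longleftrightarrow> fin_codim s' U' W'"
    and codim_iso_eq: "fin_codim s U W \<Longrightarrow> codim s U W = codim s' U' W'"
proof -
  note Q = relative_dimension.subquotient_presentation
  note I = induced_isomorphism[where f = f, OF Q[OF assms(1,3-5)] Q[OF assms(2,6-8)] f surj f_add f_scale]
  show "fin_codim s U W \<longleftrightarrow> fin_codim s' U' W'"
    and "fin_codim s U W \<Longrightarrow> codim s U W = codim s' U' W'"
    using I unfolding fin_codim_def codim_def by blast+
qed

section \<open>Finite codimension\<close>

text \<open>
  Linearly independent subsets of \<open>X\<close> are bounded in size by the dimension of the whole space, so
  a maximal one exists, and it is a basis.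
\<close>

lemma (in vectorspace) fin_dim_submodule:
  assumes "fin_dim" "submodule K X V"
  shows "vectorspace.fin_dim K (V\<lparr>carrier := X\<rparr>)"
proof -
  interpret X: vectorspace K "V\<lparr>carrier := X\<rparr>"
    using subspace_is_vs assms(2) vectorspace_axioms by (simp add: subspace_def)
  have X: "X \<subseteq> carrier V" using assms(2) by (simp add: submodule_def)
  have "finite A \<and> card A \<le> dim" if "A \<subseteq> X \<and> X.module.lin_indpt A" for A
    using that span_li_not_depend(2)[OF _ assms(2), of A] li_le_dim[OF assms(1), of A] X by auto
  moreover have "{} \<subseteq> X \<and> X.module.lin_indpt {}" by (simp add: X.module.lin_dep_def)
  ultimately obtain A where A: "finite A" "maximal A (\<lambda>A. A \<subseteq> X \<and> X.module.lin_indpt A)"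
    using maximal_exists[of "\<lambda>A. A \<subseteq> X \<and> X.module.lin_indpt A"] by blast
  then show ?thesis
    using X.max_li_is_gen[of A] by (auto simp: X.fin_dim_def maximal_def)
qed

context quotient_presentation begin

lemma span_image:
  assumes "B \<subseteq> U"
  shows "LinearCombinations.module.span class_ring V (\<pi> ` B) = \<pi> ` span B"
proof
  interpret V: vectorspace class_ring V by (rule vectorspace)
  have B: "span B \<subseteq> U" using assms subspace_U by (rule span_minimal)
  have "submodule class_ring (\<pi> ` span B) V"
  proof unfold_locales
    show "\<pi> ` span B \<subseteq> carrier V" using B by (auto simp: carrier)
    show "\<zero>\<^bsub>V\<^esub> \<in> \<pi> ` span B" using zero span_zero by (metis imageI)
  qed (use B in \<open>auto simp: add[symmetric] smult[symmetric] subset_iff span_add span_scale\<close>)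
  then show "V.module.span (\<pi> ` B) \<subseteq> \<pi> ` span B"
    by (intro V.module.span_is_subset) (auto simp: span_base)
  have B': "\<pi> ` B \<subseteq> carrier V" using assms by (auto simp: carrier)
  interpret S: submodule class_ring "V.module.span (\<pi> ` B)" V
    using V.module.span_is_submodule[OF B'] .
  have "subspace {x \<in> U. \<pi> x \<in> V.module.span (\<pi> ` B)}"
    unfolding subspace_def
    by (auto simp: add smult zero subspace_0[OF subspace_U] subspace_add[OF subspace_U]
        subspace_scale[OF subspace_U])
  moreover have "B \<subseteq> {x \<in> U. \<pi> x \<in> V.module.span (\<pi> ` B)}"
    using assms V.module.in_own_span[OF B'] by auto
  ultimately show "\<pi> ` span B \<subseteq> V.module.span (\<pi> ` B)"
    using span_minimal by blast
qed

text \<open>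
  Finiteness in terms of the ambient space, where spans can be handled by set inclusions.
\<close>

lemma fin_dim_iff_span:
  "vectorspace.fin_dim class_ring V \<longleftrightarrow> (\<exists>B. finite B \<and> B \<subseteq> U \<and> U \<subseteq> span (B \<union> W))"
proof -
  interpret V: vectorspace class_ring V by (rule vectorspace)
  have gen: "V.module.span (\<pi> ` B) = carrier V \<longleftrightarrow> U \<subseteq> span (B \<union> W)" if B: "B \<subseteq> U" for B
  proof -
    have sB: "span B \<subseteq> U" using B subspace_U by (rule span_minimal)
    have W: "span W = W" using subspace_W by simp
    have "V.module.span (\<pi> ` B) = carrier V \<longleftrightarrow> (\<forall>x\<in>U. \<exists>b\<in>span B. \<pi> x = \<pi> b)"
      using sB by (auto simp: span_image[OF B] carrier)
    also have "\<dots> \<longleftrightarrow> (\<forall>x\<in>U. \<exists>b\<in>span B. x - b \<in> W)"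
      using sB eq_iff by (intro ball_cong bex_cong refl) blast
    also have "\<dots> \<longleftrightarrow> U \<subseteq> span (B \<union> W)"
    proof -
      have "x \<in> span (B \<union> W) \<longleftrightarrow> (\<exists>b\<in>span B. x - b \<in> W)" for x
      proof -
        have "x \<in> span (B \<union> W) \<longleftrightarrow> (\<exists>b w. x = b + w \<and> b \<in> span B \<and> w \<in> W)"
          unfolding span_Un W by blast
        also have "\<dots> \<longleftrightarrow> (\<exists>b w. w = x - b \<and> b \<in> span B \<and> w \<in> W)"
          by (simp add: eq_diff_eq add.commute eq_commute[of x])
        finally show ?thesis by blast
      qed
      then show ?thesis by blast
    qed
    finally show ?thesis .
  qed
  show ?thesis
  proof
    assume "V.fin_dim"
    then obtain A where A: "finite A" "A \<subseteq> \<pi> ` U" "V.module.span A = carrier V"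
      by (auto simp: V.fin_dim_def carrier)
    obtain B where "finite B" "B \<subseteq> U" "A = \<pi> ` B"
      using finite_subset_image[OF A(1,2)] by blast
    with A(3) gen show "\<exists>B. finite B \<and> B \<subseteq> U \<and> U \<subseteq> span (B \<union> W)" by blast
  next
    assume "\<exists>B. finite B \<and> B \<subseteq> U \<and> U \<subseteq> span (B \<union> W)"
    then obtain B where B: "finite B" "B \<subseteq> U" "U \<subseteq> span (B \<union> W)" by blast
    with gen have "V.module.span (\<pi> ` B) = carrier V" by blast
    with B show "V.fin_dim"
      unfolding V.fin_dim_def by (intro exI[of _ "\<pi> ` B"]) (auto simp: carrier)
  qed
qed

end

context relative_dimension begin

lemma fin_codim_iff_span:
  assumes "subspace U" "subspace W" "W \<subseteq> U"
  shows "fin_codim scale U W \<longleftrightarrow> (\<exists>B. finite B \<and> B \<subseteq> U \<and> U \<subseteq> span (B \<union> W))"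
  using quotient_presentation.fin_dim_iff_span[OF subquotient_presentation[OF assms]]
  by (simp add: fin_codim_def)

lemma fin_codim_trans:
  assumes "subspace U" "subspace X" "subspace W" "W \<subseteq> X" "X \<subseteq> U"
    and "fin_codim scale U X" "fin_codim scale X W"
  shows "fin_codim scale U W"
proof -
  obtain B C where B: "finite B" "B \<subseteq> U" "U \<subseteq> span (B \<union> X)"
    and C: "finite C" "C \<subseteq> X" "X \<subseteq> span (C \<union> W)"
    using assms by (auto simp: fin_codim_iff_span)
  have "B \<union> X \<subseteq> span (B \<union> C \<union> W)"
    using C(3) span_mono[of "C \<union> W" "B \<union> C \<union> W"] span_superset[of "B \<union> C \<union> W"] by blast
  then have "U \<subseteq> span (B \<union> C \<union> W)" using B(3) span_minimal[OF _ subspace_span] by blast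
  with B C assms show ?thesis
    by (subst fin_codim_iff_span) (auto intro!: exI[of _ "B \<union> C"])
qed

lemma fin_codim_upper:
  assumes "subspace U" "subspace X" "subspace W" "W \<subseteq> X" "X \<subseteq> U" "fin_codim scale U W"
  shows "fin_codim scale U X"
proof -
  obtain B where B: "finite B" "B \<subseteq> U" "U \<subseteq> span (B \<union> W)"
    using assms by (auto simp: fin_codim_iff_span)
  moreover have "span (B \<union> W) \<subseteq> span (B \<union> X)" using assms by (intro span_mono) auto
  ultimately show ?thesis
    using assms by (subst fin_codim_iff_span) auto
qed

text \<open>
  Rank-nullity for the projection from \<open>U / W\<close> onto \<open>U / X\<close>, whose kernel is \<open>X / W\<close>.
\<close>

lemma
  assumes "subspace U" "subspace X" "subspace W" "W \<subseteq> X" "X \<subseteq> U" "fin_codim scale U W"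
  shows fin_codim_lower: "fin_codim scale X W"
    and codim_add: "codim scale U W = codim scale U X + codim scale X W"
proof -
  have WU: "W \<subseteq> U" using assms by blast
  note P = subquotient_presentation[OF assms(1,3) WU]
  note P' = subquotient_presentation[OF assms(1,2,5)]
  let ?V = "subquotient scale U W"
  let ?\<pi> = "\<lambda>x. (\<lambda>z. z + x) ` W"
  interpret P: quotient_presentation scale U W ?V ?\<pi> by (rule P)
  interpret P': quotient_presentation scale U X "subquotient scale U X" "\<lambda>x. (\<lambda>z. z + x) ` X"
    by (rule P')
  interpret V: vectorspace class_ring ?V by (rule P.vectorspace)
  obtain T where T: "linear_map class_ring ?V (subquotient scale U X) T"
      "\<And>x. x \<in> U \<Longrightarrow> T (?\<pi> x) = (\<lambda>z. z + x) ` X"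
    using induced_map[OF P P', of "\<lambda>x. x"] assms(4) by blast
  interpret T: linear_map class_ring ?V "subquotient scale U X" T by (rule T)
  have fin: "V.fin_dim" using assms(6) by (simp add: fin_codim_def)
  have im: "T.imT = carrier (subquotient scale U X)"
    unfolding T.im_def P.carrier P'.carrier image_image using T(2) by (rule image_cong[OF refl])
  have "T (?\<pi> x) = \<zero>\<^bsub>subquotient scale U X\<^esub> \<longleftrightarrow> x \<in> X" if "x \<in> U" for x
    unfolding T(2)[OF that] by (rule P'.kernel[OF that])
  then have ker: "T.kerT = ?\<pi> ` X"
    using assms(5) by (auto simp: T.ker_def P.carrier)
  note R = P.restrict[OF assms(2,4,5)]
  have "submodule class_ring T.kerT ?V" by (rule T.ker_is_submodule)
  then have "vectorspace.fin_dim class_ring (?V\<lparr>carrier := ?\<pi> ` X\<rparr>)"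
    using V.fin_dim_submodule[OF fin] ker by simp
  then show XW: "fin_codim scale X W" using presentation_fin_dim_iff[OF R] by simp
  have "vectorspace.dim class_ring (?V\<lparr>carrier := ?\<pi> ` X\<rparr>) = codim scale X W"
    using presentation_dim_eq[OF R XW] .
  with T.rank_nullity[OF fin] show "codim scale U W = codim scale U X + codim scale X W"
    by (simp add: im ker codim_def)
qed

text \<open>
  The quotient \<open>X / (X \<inter> N)\<close> is isomorphic to \<open>(X + N) / N\<close>, a subspace of \<open>U / N\<close>.
\<close>

lemma fin_codim_Int:
  assumes "subspace U" "subspace X" "subspace N" "N \<subseteq> U" "X \<subseteq> U" "fin_codim scale U N"
  shows "fin_codim scale X (X \<inter> N)"
proof -
  let ?S = "{x + n |x n. x \<in> X \<and> n \<in> N}"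
  have S: "subspace ?S" using assms(2,3) by (rule subspace_sums)
  have SU: "?S \<subseteq> U" using assms subspace_add[OF assms(1)] by blast
  have mem: "x + n \<in> ?S" if "x \<in> X" "n \<in> N" for x n using that by blast
  have NS: "N \<subseteq> ?S" using mem[OF subspace_0[OF assms(2)]] by auto
  have XS: "x \<in> ?S" if "x \<in> X" for x using mem[OF that subspace_0[OF assms(3)]] by simp
  have surj: "\<exists>x\<in>X. y - x \<in> N" if "y \<in> ?S" for y using that by force
  have fin: "fin_codim scale ?S N"
    by (rule fin_codim_lower[OF assms(1) S assms(3) NS SU assms(6)])
  note iso = codim_iso[where f = "\<lambda>x. x", OF relative_dimension_axioms relative_dimension_axioms
    assms(2) subspace_inter[OF assms(2,3)] _ S assms(3) NS XS _ surj]
  have "fin_codim scale X (X \<inter> N) \<longleftrightarrow> fin_codim scale ?S N" by (rule iso) auto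
  with fin show ?thesis by blast
qed

lemma codim_self [simp]: "subspace U \<Longrightarrow> codim scale U U = 0"
  and fin_codim_self [simp]: "subspace U \<Longrightarrow> fin_codim scale U U"
proof -
  assume U: "subspace U"
  show fin: "fin_codim scale U U"
    by (subst fin_codim_iff_span) (auto simp: U span_base intro!: exI[of _ "{}"])
  show "codim scale U U = 0" using codim_add[OF U U U _ _ fin] by simp
qed

end

section \<open>Finite direct sums\<close>

definition fun_scale :: "('a \<Rightarrow> 'b \<Rightarrow> 'b) \<Rightarrow> 'a \<Rightarrow> ('i \<Rightarrow> 'b) \<Rightarrow> 'i \<Rightarrow> 'b" where
  "fun_scale s c x = (\<lambda>i. s c (x i))"

text \<open>
  The direct sum of the subspaces \<open>A i\<close> over \<open>T\<close>, inside the space of all functions. Functions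
  vanish outside \<open>T\<close>, so that sums over different index sets live in one ambient space.
\<close>

definition sections :: "'i set \<Rightarrow> ('i \<Rightarrow> 'b::zero set) \<Rightarrow> ('i \<Rightarrow> 'b) set" where
  "sections T A = {x. \<forall>i. if i \<in> T then x i \<in> A i else x i = 0}"

lemma sections_mono: "(\<And>i. i \<in> T \<Longrightarrow> A i \<subseteq> B i) \<Longrightarrow> sections T A \<subseteq> sections T B"
  by (force simp: sections_def)

context relative_dimension begin

lemma relative_dimension_fun_scale: "relative_dimension (fun_scale scale)"
  by unfold_locales
    (auto simp: fun_scale_def fun_eq_iff scale_right_distrib scale_left_distrib)

lemma subspace_sections:
  assumes "\<And>i. i \<in> T \<Longrightarrow> subspace (A i)"
  shows "module.subspace (fun_scale scale) (sections T A)"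
proof -
  interpret F: relative_dimension "fun_scale scale" by (rule relative_dimension_fun_scale)
  show ?thesis
    unfolding F.subspace_def sections_def
    using assms by (auto simp: fun_scale_def subspace_0 subspace_add subspace_scale)
qed

lemma direct_sum_presentation:
  assumes P: "\<And>i. i \<in> T \<Longrightarrow> quotient_presentation scale (A i) (B i) (V i) (p i)"
  shows "quotient_presentation (fun_scale scale) (sections T A) (sections T B)
    (finite_direct_sum T V) (\<lambda>x. \<lambda>i\<in>T. p i (x i))"
proof -
  interpret F: relative_dimension "fun_scale scale" by (rule relative_dimension_fun_scale)
  note Q = quotient_presentation.subspace_U[OF P] quotient_presentation.subspace_W[OF P]
    quotient_presentation.W_sub_U[OF P]
  show ?thesis
  proof unfold_locales
    show "F.subspace (sections T A)" "F.subspace (sections T B)" "sections T B \<subseteq> sections T A"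
      using Q by (auto intro!: subspace_sections sections_mono)
    show "carrier (finite_direct_sum T V) = (\<lambda>x. \<lambda>i\<in>T. p i (x i)) ` sections T A"
    proof (intro subset_antisym subsetI)
      fix f assume f: "f \<in> carrier (finite_direct_sum T V)"
      then have "\<forall>i\<in>T. \<exists>y. y \<in> A i \<and> f i = p i y"
        using quotient_presentation.carrier[OF P]
        by (auto simp: finite_direct_sum_def PiE_iff image_iff)
      then obtain y where y: "\<And>i. i \<in> T \<Longrightarrow> y i \<in> A i \<and> f i = p i (y i)"
        by metis
      have "f = (\<lambda>i\<in>T. p i (if i \<in> T then y i else 0))"
        using f y by (auto simp: finite_direct_sum_def PiE_iff extensional_def fun_eq_iff)
      moreover have "(\<lambda>i. if i \<in> T then y i else 0) \<in> sections T A"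
        using y by (simp add: sections_def)
      ultimately show "f \<in> (\<lambda>x. \<lambda>i\<in>T. p i (x i)) ` sections T A" by (rule image_eqI)
    qed (use quotient_presentation.carrier[OF P] in
        \<open>auto simp: finite_direct_sum_def sections_def split: if_splits\<close>)
    show "(\<lambda>i\<in>T. p i ((x + y) i)) = (\<lambda>i\<in>T. p i (x i)) \<oplus>\<^bsub>finite_direct_sum T V\<^esub> (\<lambda>i\<in>T. p i (y i))"
      if "x \<in> sections T A" "y \<in> sections T A" for x y
      using that quotient_presentation.add[OF P]
      by (auto simp: finite_direct_sum_def sections_def fun_eq_iff)
    show "(\<lambda>i\<in>T. p i (fun_scale scale c x i)) = c \<odot>\<^bsub>finite_direct_sum T V\<^esub> (\<lambda>i\<in>T. p i (x i))"
      if "x \<in> sections T A" for c x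
      using that quotient_presentation.smult[OF P]
      by (auto simp: finite_direct_sum_def sections_def fun_eq_iff fun_scale_def)
    show "(\<lambda>i\<in>T. p i (x i)) = \<zero>\<^bsub>finite_direct_sum T V\<^esub> \<longleftrightarrow> x \<in> sections T B"
      if x: "x \<in> sections T A" for x
    proof -
      have "x i \<in> A i" if "i \<in> T" for i using x that by (simp add: sections_def)
      then have "p i (x i) = \<zero>\<^bsub>V i\<^esub> \<longleftrightarrow> x i \<in> B i" if "i \<in> T" for i
        using quotient_presentation.kernel[OF P] that by blast
      moreover have "x i = 0" if "i \<notin> T" for i using x that by (auto simp: sections_def)
      ultimately show ?thesis
        by (auto simp: finite_direct_sum_def sections_def fun_eq_iff)
    qed
  qed
qed

text \<open>
  The summands are enlarged from \<open>B i\<close> to \<open>A i\<close> one index at a time; each step changes the direct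
  sum by \<open>A a / B a\<close>.
\<close>

lemma
  assumes "finite T" and A: "\<And>i. i \<in> T \<Longrightarrow> subspace (A i)" and B: "\<And>i. i \<in> T \<Longrightarrow> subspace (B i)"
    and BA: "\<And>i. i \<in> T \<Longrightarrow> B i \<subseteq> A i" and fin: "\<And>i. i \<in> T \<Longrightarrow> fin_codim scale (A i) (B i)"
  shows fin_codim_sections: "fin_codim (fun_scale scale) (sections T A) (sections T B)"
    and codim_sections: "codim (fun_scale scale) (sections T A) (sections T B)
      = (\<Sum>i\<in>T. codim scale (A i) (B i))"
proof -
  interpret F: relative_dimension "fun_scale scale" by (rule relative_dimension_fun_scale)
  define S where "S D = sections T (\<lambda>i. if i \<in> D then A i else B i)" for D
  have S: "F.subspace (S D)" for D
    unfolding S_def using A B by (intro subspace_sections) auto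
  have S_mono: "S D \<subseteq> S D'" if "D \<subseteq> D'" for D D'
    unfolding S_def using that BA by (intro sections_mono) auto
  have "fin_codim (fun_scale scale) (S D) (S {}) \<and>
      codim (fun_scale scale) (S D) (S {}) = (\<Sum>i\<in>D. codim scale (A i) (B i))"
    if "finite D" "D \<subseteq> T" for D
    using that
  proof (induction D rule: finite_induct)
    case empty
    then show ?case using S by simp
  next
    case (insert a D)
    have a: "a \<in> T" using insert by blast
    have surj: "\<exists>x\<in>S (insert a D). y - x a \<in> B a" if "y \<in> A a" for y
    proof
      show "(\<lambda>i. if i = a then y else 0) \<in> S (insert a D)"
        using that A B a by (auto simp: S_def sections_def subspace_0)
    qed (use subspace_0[OF B[OF a]] in simp)
    note iso = codim_iso[where f = "\<lambda>x. x a", OF F.relative_dimension_axioms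
        relative_dimension_axioms S S S_mono[OF subset_insertI] A[OF a] B[OF a] BA[OF a] _ _ surj]
    have "x a \<in> A a" if "x \<in> S (insert a D)" for x
      using that a by (auto simp: S_def sections_def split: if_splits)
    moreover have "x a \<in> B a \<longleftrightarrow> x \<in> S D" if "x \<in> S (insert a D)" for x
      using that a insert.hyps by (auto simp: S_def sections_def split: if_splits)
    ultimately have step: "fin_codim (fun_scale scale) (S (insert a D)) (S D)"
      "codim (fun_scale scale) (S (insert a D)) (S D) = codim scale (A a) (B a)"
      using iso fin[OF a] by (auto simp: fun_scale_def)
    have IH: "fin_codim (fun_scale scale) (S D) (S {})"
      "codim (fun_scale scale) (S D) (S {}) = (\<Sum>i\<in>D. codim scale (A i) (B i))"
      using insert by auto
    have total: "fin_codim (fun_scale scale) (S (insert a D)) (S {})"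
      by (rule F.fin_codim_trans[OF S S S S_mono S_mono step(1) IH(1)]) auto
    have "codim (fun_scale scale) (S (insert a D)) (S {})
        = codim (fun_scale scale) (S (insert a D)) (S D) + codim (fun_scale scale) (S D) (S {})"
      by (rule F.codim_add[OF S S S S_mono S_mono total]) auto
    with total step IH insert.hyps show ?case by simp
  qed
  from this[OF assms(1) subset_refl]
  have *: "fin_codim (fun_scale scale) (S T) (S {})"
    "codim (fun_scale scale) (S T) (S {}) = (\<Sum>i\<in>T. codim scale (A i) (B i))" by auto
  have "S T = sections T A" "S {} = sections T B" by (auto simp: S_def sections_def)
  with * show "fin_codim (fun_scale scale) (sections T A) (sections T B)"
    "codim (fun_scale scale) (sections T A) (sections T B)
      = (\<Sum>i\<in>T. codim scale (A i) (B i))" by simp_all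
qed

end

section \<open>The complex of a decreasing family of subspaces\<close>

text \<open>
  The argument about the complex uses only that the spaces \<open>M(v + e_I)\<close> decrease as \<open>I\<close> grows.
  The space \<open>M(v + 1)\<close> is the member of the family at the full index set. The complex is
  lifted to the ambient space: chains are families with components in \<open>M I\<close>, and instead of
  being equal to zero they may be null, with components in \<open>M UNIV\<close>.
\<close>

locale decreasing_family = relative_dimension scale
  for scale :: "'a::field \<Rightarrow> 'b::ab_group_add \<Rightarrow> 'b" (infixr "*s" 75) +
  fixes M :: "'r::{finite,linorder} set \<Rightarrow> 'b set"
  assumes subspace_M: "subspace (M I)"
    and M_antimono: "I \<subseteq> J \<Longrightarrow> M J \<subseteq> M I"
begin

definition incidence_sign :: "'r \<Rightarrow> 'r set \<Rightarrow> 'a" where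
  "incidence_sign a J = (- 1) ^ card {b \<in> insert a J. b \<le> a}"

definition bd :: "('r set \<Rightarrow> 'b) \<Rightarrow> 'r set \<Rightarrow> 'b" where
  "bd x J = (\<Sum>a\<in>- J. incidence_sign a J *s x (insert a J))"

definition final_index :: 'r where "final_index = Max UNIV"

text \<open>
  The contraction of the cone: the component at \<open>K\<close> is moved to \<open>insert final_index K\<close>. The sign is
  the one with which the boundary map moves it back.
\<close>

definition contraction :: "('r set \<Rightarrow> 'b) \<Rightarrow> 'r set \<Rightarrow> 'b" where
  "contraction x I = (if final_index \<in> I then (- 1) ^ card I *s x (I - {final_index}) else 0)"

lemma le_final: "(a :: 'r) \<le> final_index"
  by (simp add: final_index_def)

lemma incidence_sign_final:
  assumes "final_index \<notin> J"
  shows "incidence_sign final_index J = - ((- 1) ^ card J)"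
proof -
  have "{b \<in> insert final_index J. b \<le> final_index} = insert final_index J" by (auto simp: le_final)
  with assms show ?thesis by (simp add: incidence_sign_def)
qed

lemma incidence_sign_insert_greater: "a < b \<Longrightarrow> incidence_sign a (insert b J) = incidence_sign a J"
  unfolding incidence_sign_def by (rule arg_cong[where f = "\<lambda>S. (- 1) ^ card S"]) auto

lemma incidence_sign_insert_less:
  assumes "a < b" "a \<notin> J"
  shows "incidence_sign b (insert a J) = - incidence_sign b J"
proof -
  have "{c \<in> insert b (insert a J). c \<le> b} = insert a {c \<in> insert b J. c \<le> b}"
    using assms by auto
  then show ?thesis using assms by (simp add: incidence_sign_def)
qed

text \<open>
  Removing two indices in either order gives opposite signs, so the terms for pairs
  \<open>a < b\<close> cancel against those for \<open>a > b\<close>.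
\<close>

lemma bd_bd: "bd (bd x) = 0"
proof
  fix J
  let ?F = "\<lambda>(a, b). incidence_sign a J *s incidence_sign b (insert a J) *s x (insert b (insert a J))"
  let ?P = "{(a, b). a \<notin> J \<and> b \<notin> J \<and> a < b}"
  have "bd (bd x) J = (\<Sum>a\<in>- J. \<Sum>b\<in>- insert a J. ?F (a, b))"
    by (simp add: bd_def scale_sum_right)
  also have "\<dots> = (\<Sum>p\<in>Sigma (- J) (\<lambda>a. - insert a J). ?F p)"
    by (subst sum.Sigma) auto
  also have "Sigma (- J) (\<lambda>a. - insert a J) = ?P \<union> prod.swap ` ?P"
    by (auto simp: image_iff neq_iff)
  also have "(\<Sum>p\<in>?P \<union> prod.swap ` ?P. ?F p) = (\<Sum>p\<in>?P. ?F p) + (\<Sum>p\<in>prod.swap ` ?P. ?F p)"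
    by (rule sum.union_disjoint) auto
  also have "(\<Sum>p\<in>prod.swap ` ?P. ?F p) = (\<Sum>p\<in>?P. - ?F p)"
    by (subst sum.reindex)
      (auto simp: inj_on_def incidence_sign_insert_greater incidence_sign_insert_less insert_commute mult.commute
        intro!: sum.cong)
  finally show "bd (bd x) J = 0 J" by (simp add: sum_negf)
qed

text \<open>
  At \<open>J\<close> without the final index, only the final index contributes to the boundary of the
  contraction and returns \<open>x J\<close>. At \<open>J\<close> containing it, the same index contributes \<open>x J\<close> to
  the boundary taken first, and all other terms cancel because the final index is larger than the
  other ones and leaves their signs unchanged.
\<close>

lemma contraction_homotopy: "bd (contraction x) + contraction (bd x) = x"
proof
  fix J
  show "(bd (contraction x) + contraction (bd x)) J = x J"
  proof (cases "final_index \<in> J")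
    case False
    have "bd (contraction x) J = (\<Sum>a\<in>{final_index}. incidence_sign a J *s contraction x (insert a J))"
      unfolding bd_def using False
      by (intro sum.mono_neutral_right) (auto simp: contraction_def)
    also have "\<dots> = x J"
      using False by (simp add: contraction_def incidence_sign_final Diff_insert_absorb flip: power_add mult_2)
    finally show ?thesis using False by (simp add: contraction_def)
  next
    case True
    define K where "K = J - {final_index}"
    have J: "J = insert final_index K" "final_index \<notin> K" using True by (auto simp: K_def)
    have sq: "(- 1) ^ card K * (- 1) ^ card K = (1 :: 'a)"
      by (simp flip: power_add mult_2)
    have "- K = insert final_index (- J)" using J by auto
    then have "contraction (bd x) J = - ((- 1) ^ card K) *s (incidence_sign final_index K *s x J + (\<Sum>a\<in>- J. incidence_sign a K *s x (insert a K)))"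
      using J by (simp add: contraction_def bd_def)
    moreover have "bd (contraction x) J = (\<Sum>a\<in>- J. (- 1) ^ card K *s incidence_sign a K *s x (insert a K))"
      unfolding bd_def
    proof (rule sum.cong[OF refl])
      fix a assume a: "a \<in> - J"
      then have "a < final_index" using True le_final[of a] by (metis ComplD order_le_less)
      then have s: "incidence_sign a J = incidence_sign a K" using J(1) incidence_sign_insert_greater by simp
      have "insert a J - {final_index} = insert a K" "card (insert a J) = Suc (Suc (card K))"
        using a J by auto
      then show "incidence_sign a J *s contraction x (insert a J) = (- 1) ^ card K *s incidence_sign a K *s x (insert a K)"
        using True by (simp add: contraction_def s mult.commute)
    qed
    ultimately show ?thesis
      using J(2) by (simp add: incidence_sign_final scale_right_diff_distrib scale_sum_right sq sum_negf)
  qed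
qed


lemma contraction_zero [simp]: "contraction 0 = 0"
  by (simp add: contraction_def fun_eq_iff)

definition degree_indices :: "int \<Rightarrow> 'r set set" where
  "degree_indices i = {I. int (card I) = i}"

definition chains :: "int \<Rightarrow> ('r set \<Rightarrow> 'b) set" where
  "chains i = sections (degree_indices i) M"

definition null_chains :: "int \<Rightarrow> ('r set \<Rightarrow> 'b) set" where
  "null_chains i = sections (degree_indices i) (\<lambda>_. M UNIV)"

text \<open>
  The subcomplex with quotient terms \<open>V_K / V_(K \<union> r)\<close>: a component at \<open>K\<close> not containing the
  final index is required to lie in \<open>M (insert final_index K)\<close>, while a component at \<open>K\<close> containing
  it is arbitrary.
\<close>

definition final_chains :: "int \<Rightarrow> ('r set \<Rightarrow> 'b) set" where
  "final_chains i = sections (degree_indices i) (\<lambda>I. M (insert final_index I))"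

abbreviation cscale :: "'a \<Rightarrow> ('r set \<Rightarrow> 'b) \<Rightarrow> 'r set \<Rightarrow> 'b" where
  "cscale \<equiv> fun_scale scale"

sublocale F: relative_dimension cscale
  by (rule relative_dimension_fun_scale)

lemma subspace_chains:
  "F.subspace (chains i)" "F.subspace (null_chains i)" "F.subspace (final_chains i)"
  unfolding chains_def null_chains_def final_chains_def
  by (intro subspace_sections subspace_M)+

lemma null_le_final: "null_chains i \<subseteq> final_chains i"
  and final_le_chains: "final_chains i \<subseteq> chains i"
  unfolding chains_def null_chains_def final_chains_def
  by (intro sections_mono M_antimono; blast)+

lemma bd_add: "bd (x + y) = bd x + bd y"
  by (simp add: bd_def fun_eq_iff scale_right_distrib sum.distrib)

lemma bd_cscale: "bd (cscale c x) = cscale c (bd x)"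
  by (simp add: bd_def fun_eq_iff fun_scale_def scale_sum_right mult.commute)

lemma bd_zero [simp]: "bd 0 = 0"
  by (simp add: bd_def fun_eq_iff)

lemma bd_diff: "bd (x - y) = bd x - bd y"
  by (metis add_diff_cancel bd_add diff_add_cancel)

lemma bd_sections:
  assumes x: "x \<in> sections (degree_indices i) A"
    and "\<And>J. subspace (A' J)" "\<And>a J. a \<notin> J \<Longrightarrow> A (insert a J) \<subseteq> A' J"
  shows "bd x \<in> sections (degree_indices (i - 1)) A'"
proof -
  have xI: "x I \<in> A I" if "int (card I) = i" for I
    using x that by (simp add: sections_def degree_indices_def)
  have x0: "x I = 0" if "int (card I) \<noteq> i" for I
    using x that by (auto simp: sections_def degree_indices_def)
  have "bd x J \<in> A' J" if J: "int (card J) = i - 1" for J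
    unfolding bd_def
  proof (intro subspace_sum subspace_scale assms(2))
    fix a assume "a \<in> - J"
    with J have "int (card (insert a J)) = i" by simp
    with \<open>a \<in> - J\<close> show "x (insert a J) \<in> A' J" using xI assms(3) by blast
  qed
  moreover have "bd x J = 0" if J: "int (card J) \<noteq> i - 1" for J
    unfolding bd_def using J by (intro sum.neutral) (auto simp: x0)
  ultimately show ?thesis by (simp add: sections_def degree_indices_def)
qed

lemma bd_chains: "x \<in> chains i \<Longrightarrow> bd x \<in> chains (i - 1)"
  unfolding chains_def by (rule bd_sections) (auto intro: subspace_M M_antimono[THEN subsetD])

lemma bd_null_chains: "x \<in> null_chains i \<Longrightarrow> bd x \<in> null_chains (i - 1)"
  unfolding null_chains_def by (rule bd_sections) (auto simp: subspace_M)

lemma bd_final_chains: "x \<in> final_chains i \<Longrightarrow> bd x \<in> final_chains (i - 1)"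
  unfolding final_chains_def by (rule bd_sections) (auto simp: subspace_M intro!: M_antimono)

lemma contraction_sections:
  assumes x: "x \<in> sections (degree_indices i) A"
    and "\<And>J. subspace (A' J)" "\<And>J. A J \<subseteq> A' (insert final_index J)"
  shows "contraction x \<in> sections (degree_indices (i + 1)) A'"
proof -
  have card: "int (card (I - {final_index})) = i \<longleftrightarrow> int (card I) = i + 1" if "final_index \<in> I" for I
  proof -
    have "card I = Suc (card (I - {final_index}))"
      using card_Suc_Diff1[OF finite that] by (rule sym)
    then show ?thesis by simp
  qed
  have "contraction x I \<in> A' I" if I: "int (card I) = i + 1" for I
  proof (cases "final_index \<in> I")
    case True
    then have "x (I - {final_index}) \<in> A (I - {final_index})"
      using x I card[OF True] by (simp add: sections_def degree_indices_def)
    with assms(3)[of "I - {final_index}"] True show ?thesis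
      by (auto simp: contraction_def insert_absorb intro!: subspace_scale assms(2))
  qed (simp add: contraction_def subspace_0 assms(2))
  moreover have "contraction x I = 0" if I: "int (card I) \<noteq> i + 1" for I
  proof (cases "final_index \<in> I")
    case True
    then have "x (I - {final_index}) = 0"
      using x I card[OF True] by (auto simp: sections_def degree_indices_def)
    then show ?thesis by (simp add: contraction_def)
  qed (simp add: contraction_def)
  ultimately show ?thesis by (simp add: sections_def degree_indices_def)
qed

lemma contraction_final_chains: "x \<in> final_chains i \<Longrightarrow> contraction x \<in> final_chains (i + 1)"
  unfolding final_chains_def by (rule contraction_sections) (auto simp: subspace_M)

lemma contraction_null_chains: "x \<in> null_chains i \<Longrightarrow> contraction x \<in> null_chains (i + 1)"
  unfolding null_chains_def by (rule contraction_sections) (auto simp: subspace_M)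

text \<open>
  Cycles and boundaries of the complex modulo null chains, and below of the complex
  modulo the subcomplex of final chains, each lifted to the ambient space.
\<close>

definition cycles :: "int \<Rightarrow> ('r set \<Rightarrow> 'b) set" where
  "cycles i = {x \<in> chains i. bd x \<in> null_chains (i - 1)}"

definition boundaries :: "int \<Rightarrow> ('r set \<Rightarrow> 'b) set" where
  "boundaries i = {bd c + n |c n. c \<in> chains (i + 1) \<and> n \<in> null_chains i}"

definition final_cycles :: "int \<Rightarrow> ('r set \<Rightarrow> 'b) set" where
  "final_cycles i = {x \<in> chains i. bd x \<in> final_chains (i - 1)}"

definition final_boundaries :: "int \<Rightarrow> ('r set \<Rightarrow> 'b) set" where
  "final_boundaries i = {bd c + n |c n. c \<in> chains (i + 1) \<and> n \<in> final_chains i}"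

lemma
  assumes C: "F.subspace C" and N: "F.subspace N"
  shows subspace_bd_vimage: "F.subspace {x \<in> C. bd x \<in> N}"
    and subspace_bd_image: "F.subspace {bd c + n |c n. c \<in> C \<and> n \<in> N}"
proof -
  show "F.subspace {x \<in> C. bd x \<in> N}"
    using F.subspace_0[OF C] F.subspace_0[OF N] F.subspace_add[OF C] F.subspace_add[OF N]
      F.subspace_scale[OF C] F.subspace_scale[OF N]
    by (simp add: F.subspace_def bd_add bd_cscale)
  have "F.subspace (bd ` C)"
    unfolding F.subspace_def
  proof (intro conjI ballI allI)
    show "0 \<in> bd ` C" using F.subspace_0[OF C] by (intro image_eqI[of _ _ 0]) auto
  next
    fix x y assume "x \<in> bd ` C" "y \<in> bd ` C"
    then show "x + y \<in> bd ` C" using F.subspace_add[OF C] by (auto simp flip: bd_add)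
  next
    fix c x assume "x \<in> bd ` C"
    then show "cscale c x \<in> bd ` C" using F.subspace_scale[OF C] by (auto simp flip: bd_cscale)
  qed
  then have "F.subspace {x + y |x y. x \<in> bd ` C \<and> y \<in> N}" using N by (rule F.subspace_sums)
  also have "{x + y |x y. x \<in> bd ` C \<and> y \<in> N} = {bd c + n |c n. c \<in> C \<and> n \<in> N}" by blast
  finally show "F.subspace {bd c + n |c n. c \<in> C \<and> n \<in> N}" .
qed

lemma subspace_cycles:
  "F.subspace (cycles i)" "F.subspace (boundaries i)"
  "F.subspace (final_cycles i)" "F.subspace (final_boundaries i)"
  unfolding cycles_def boundaries_def final_cycles_def final_boundaries_def
  by (intro subspace_bd_vimage subspace_bd_image subspace_chains)+

lemma null_le_boundaries: "null_chains i \<subseteq> boundaries i"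
  and final_le_boundaries: "final_chains i \<subseteq> final_boundaries i"
proof -
  have "x = bd 0 + x" "0 \<in> chains (i + 1)" for x
    by (simp_all add: F.subspace_0[OF subspace_chains(1)])
  then show "null_chains i \<subseteq> boundaries i" "final_chains i \<subseteq> final_boundaries i"
    unfolding boundaries_def final_boundaries_def by blast+
qed

lemma boundaries_le_cycles: "boundaries i \<subseteq> cycles i"
proof
  fix x assume "x \<in> boundaries i"
  then obtain c n where x: "x = bd c + n" "c \<in> chains (i + 1)" "n \<in> null_chains i"
    by (auto simp: boundaries_def)
  moreover have "bd c \<in> chains i" using bd_chains[OF x(2)] by simp
  ultimately show "x \<in> cycles i"
    using null_le_final final_le_chains bd_null_chains[OF x(3)]
    by (auto simp: cycles_def bd_add bd_bd intro!: F.subspace_add[OF subspace_chains(1)])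
qed

lemma final_boundaries_le_cycles: "final_boundaries i \<subseteq> final_cycles i"
proof
  fix x assume "x \<in> final_boundaries i"
  then obtain c n where x: "x = bd c + n" "c \<in> chains (i + 1)" "n \<in> final_chains i"
    by (auto simp: final_boundaries_def)
  moreover have "bd c \<in> chains i" using bd_chains[OF x(2)] by simp
  ultimately show "x \<in> final_cycles i"
    using final_le_chains bd_final_chains[OF x(3)]
    by (auto simp: final_cycles_def bd_add bd_bd intro!: F.subspace_add[OF subspace_chains(1)])
qed

text \<open>
  Dividing out the final chains does not change the homology, since they are contractible. If
  \<open>x = bd c + e\<close> is a cycle and \<open>e\<close> a final chain, the homotopy identity rewrites \<open>e\<close> as a
  boundary plus a null chain. If \<open>y\<close> is a cycle modulo the final chains, subtracting
  the contraction of \<open>bd y\<close> makes its boundary zero.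
\<close>

lemma homology_iso:
  "fin_codim cscale (cycles i) (boundaries i) \<longleftrightarrow>
     fin_codim cscale (final_cycles i) (final_boundaries i)"
  "fin_codim cscale (cycles i) (boundaries i) \<Longrightarrow>
     codim cscale (cycles i) (boundaries i) = codim cscale (final_cycles i) (final_boundaries i)"
proof -
  have 1: "x \<in> final_cycles i" if "x \<in> cycles i" for x
    using that null_le_final by (auto simp: cycles_def final_cycles_def)
  have 2: "x \<in> final_boundaries i \<longleftrightarrow> x \<in> boundaries i" if x: "x \<in> cycles i" for x
  proof
    assume "x \<in> final_boundaries i"
    then obtain c e where x': "x = bd c + e" "c \<in> chains (i + 1)" "e \<in> final_chains i"
      by (auto simp: final_boundaries_def)
    have "bd e \<in> null_chains (i - 1)" using x x'(1) by (simp add: cycles_def bd_add bd_bd)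
    then have n: "contraction (bd e) \<in> null_chains i" using contraction_null_chains by fastforce
    have "contraction e \<in> chains (i + 1)"
      using contraction_final_chains[OF x'(3)] final_le_chains by blast
    then have "c + contraction e \<in> chains (i + 1)"
      using x'(2) F.subspace_add[OF subspace_chains(1)] by blast
    moreover have "x = bd (c + contraction e) + contraction (bd e)"
      using contraction_homotopy[of e] x'(1) by (simp add: bd_add add.assoc)
    ultimately show "x \<in> boundaries i" using n by (auto simp: boundaries_def)
  qed (use null_le_final in \<open>auto simp: boundaries_def final_boundaries_def\<close>)
  have 3: "\<exists>x\<in>cycles i. y - x \<in> final_boundaries i" if y: "y \<in> final_cycles i" for y
  proof
    let ?e = "contraction (bd y)"
    have e: "?e \<in> final_chains i"
      using y contraction_final_chains[of "bd y" "i - 1"] by (simp add: final_cycles_def)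
    have "bd ?e = bd y"
      using contraction_homotopy[of "bd y"] contraction_zero by (simp add: bd_bd)
    then show "y - ?e \<in> cycles i"
      using y e final_le_chains F.subspace_0[OF subspace_chains(2)]
      by (auto simp: cycles_def final_cycles_def bd_diff intro!: F.subspace_diff[OF subspace_chains(1)])
    show "y - (y - ?e) \<in> final_boundaries i" using e final_le_boundaries by auto
  qed
  note iso = codim_iso[where f = "\<lambda>x. x", OF F.relative_dimension_axioms F.relative_dimension_axioms
    subspace_cycles(1,2) boundaries_le_cycles subspace_cycles(3,4) final_boundaries_le_cycles 1 2 3]
  show "fin_codim cscale (cycles i) (boundaries i) \<longleftrightarrow>
      fin_codim cscale (final_cycles i) (final_boundaries i)"
    "fin_codim cscale (cycles i) (boundaries i) \<Longrightarrow>
      codim cscale (cycles i) (boundaries i) = codim cscale (final_cycles i) (final_boundaries i)"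
    using iso by auto
qed

text \<open>
  The boundary map induces an isomorphism from chains modulo cycles to boundaries, here in the
  complex modulo the final chains.
\<close>

lemma codim_cycles_eq_boundaries:
  "fin_codim cscale (chains i) (final_cycles i) \<longleftrightarrow>
     fin_codim cscale (final_boundaries (i - 1)) (final_chains (i - 1))"
  "fin_codim cscale (chains i) (final_cycles i) \<Longrightarrow>
     codim cscale (chains i) (final_cycles i)
       = codim cscale (final_boundaries (i - 1)) (final_chains (i - 1))"
proof -
  have le: "final_cycles i \<subseteq> chains i" by (auto simp: final_cycles_def)
  have 1: "bd x \<in> final_boundaries (i - 1)" if "x \<in> chains i" for x
  proof -
    have "bd x = bd x + 0" by simp
    with that F.subspace_0[OF subspace_chains(3)] show ?thesis
      unfolding final_boundaries_def diff_add_cancel by blast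
  qed
  have 2: "bd x \<in> final_chains (i - 1) \<longleftrightarrow> x \<in> final_cycles i" if "x \<in> chains i" for x
    using that by (simp add: final_cycles_def)
  have 3: "\<exists>x\<in>chains i. y - bd x \<in> final_chains (i - 1)" if Y: "y \<in> final_boundaries (i - 1)" for y
  proof -
    obtain c n where y: "y = bd c + n" "c \<in> chains i" "n \<in> final_chains (i - 1)"
      using Y unfolding final_boundaries_def diff_add_cancel by blast
    then show ?thesis by (intro bexI[of _ c]) simp_all
  qed
  note iso = codim_iso[where f = bd, OF F.relative_dimension_axioms F.relative_dimension_axioms
    subspace_chains(1) subspace_cycles(3) le subspace_cycles(4) subspace_chains(3) final_le_boundaries
    1 2 3 bd_add bd_cscale]
  show "fin_codim cscale (chains i) (final_cycles i) \<longleftrightarrow>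
      fin_codim cscale (final_boundaries (i - 1)) (final_chains (i - 1))"
    "fin_codim cscale (chains i) (final_cycles i) \<Longrightarrow>
      codim cscale (chains i) (final_cycles i)
        = codim cscale (final_boundaries (i - 1)) (final_chains (i - 1))"
    using iso by auto
qed

lemma final_cycles_0: "final_cycles 0 = chains 0"
proof -
  have "bd x = 0" if "x \<in> chains 0" for x
  proof
    fix J
    have "x (insert a J) = 0" for a
      using that by (auto simp: chains_def sections_def degree_indices_def split: if_splits)
    then show "bd x J = 0 J" by (simp add: bd_def)
  qed
  then show ?thesis
    using F.subspace_0[OF subspace_chains(3)] by (auto simp: final_cycles_def)
qed

text \<open>
  In the top degree there is only the full index set, where \<open>V_I\<close> is zero.
\<close>

lemma final_boundaries_top: "final_boundaries (int CARD('r) - 1) = final_chains (int CARD('r) - 1)"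
proof -
  have "chains (int CARD('r)) = null_chains (int CARD('r))"
    unfolding chains_def null_chains_def sections_def degree_indices_def
    using card_subset_eq[OF finite subset_UNIV] by auto
  then have "bd c \<in> final_chains (int CARD('r) - 1)" if "c \<in> chains (int CARD('r))" for c
    using that bd_null_chains null_le_final by blast
  then show ?thesis
    by (intro subset_antisym final_le_boundaries)
      (auto simp: final_boundaries_def intro!: F.subspace_add[OF subspace_chains(3)])
qed

text \<open>
  Each term of the quotient complex has dimension \<open>b (i - 1) + h i + b i\<close>, where \<open>h\<close> and \<open>b\<close> are the
  dimensions of homology and boundaries, so the \<open>b\<close> cancel in the alternating sum.
\<close>

theorem homology_euler_characteristic:
  assumes fin: "\<And>K. final_index \<notin> K \<Longrightarrow> fin_codim scale (M K) (M (insert final_index K))"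
  shows fin_codim_homology: "fin_codim cscale (cycles i) (boundaries i)"
    and "(\<Sum>i<CARD('r). (- 1) ^ i * int (codim cscale (cycles (int i)) (boundaries (int i))))
      = (\<Sum>K\<in>Pow (- {final_index}). (- 1) ^ card K * int (codim scale (M K) (M (insert final_index K))))"
proof -
  have fin_all: "fin_codim scale (M K) (M (insert final_index K))" for K
    using fin[of K] by (cases "final_index \<in> K") (simp_all add: insert_absorb subspace_M)
  have fin_chains: "fin_codim cscale (chains i) (final_chains i)" for i
    unfolding chains_def final_chains_def
    by (intro fin_codim_sections) (auto intro: subspace_M fin_all M_antimono[THEN subsetD])
  have codim_chains: "codim cscale (chains i) (final_chains i)
      = (\<Sum>I\<in>degree_indices i. codim scale (M I) (M (insert final_index I)))" for i
    unfolding chains_def final_chains_def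
    by (intro codim_sections) (auto intro: subspace_M fin_all M_antimono[THEN subsetD])
  have le: "final_cycles i \<subseteq> chains i" for i by (auto simp: final_cycles_def)
  note sub = subspace_chains subspace_cycles
  have fin_b_chains: "fin_codim cscale (final_cycles i) (final_chains i)" for i
    by (rule F.fin_codim_lower[OF sub(1,6,3) _ le fin_chains])
      (use final_le_boundaries final_boundaries_le_cycles in blast)
  have fin_h: "fin_codim cscale (final_cycles i) (final_boundaries i)" for i
    by (rule F.fin_codim_upper[OF sub(6,7,3) final_le_boundaries final_boundaries_le_cycles fin_b_chains])
  show "fin_codim cscale (cycles i) (boundaries i)" for i
    using fin_h homology_iso(1) by blast
  define q h b where "q i = int (codim cscale (chains i) (final_chains i))"
    and "h i = int (codim cscale (cycles i) (boundaries i))"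
    and "b i = int (codim cscale (final_boundaries i) (final_chains i))" for i
  have rec: "q i = b (i - 1) + h i + b i" for i
  proof -
    have "codim cscale (chains i) (final_chains i)
        = codim cscale (chains i) (final_cycles i) + codim cscale (final_cycles i) (final_chains i)"
      by (rule F.codim_add[OF sub(1,6,3) _ le fin_chains])
        (use final_le_boundaries final_boundaries_le_cycles in blast)
    moreover have "codim cscale (final_cycles i) (final_chains i)
        = codim cscale (final_cycles i) (final_boundaries i) + codim cscale (final_boundaries i) (final_chains i)"
      by (rule F.codim_add[OF sub(6,7,3) final_le_boundaries final_boundaries_le_cycles fin_b_chains])
    moreover have "fin_codim cscale (chains i) (final_cycles i)"
      by (rule F.fin_codim_upper[OF sub(1,6,3) _ le fin_chains])
        (use final_le_boundaries final_boundaries_le_cycles in blast)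
    ultimately show ?thesis
      using codim_cycles_eq_boundaries(2)[of i] homology_iso[of i] fin_h[of i]
      by (simp add: q_def h_def b_def)
  qed
  have b0: "b (-1) = 0"
    using codim_cycles_eq_boundaries[of 0] sub(1) by (simp add: b_def final_cycles_0)
  have telescope: "(\<Sum>i<n. (- 1) ^ i * h (int i)) = (\<Sum>i<n. (- 1) ^ i * q (int i)) + (- 1) ^ n * b (int n - 1)" for n
  proof (induction n)
    case (Suc n)
    then show ?case by (simp add: rec algebra_simps)
  qed (simp add: b0)
  have "b (int CARD('r) - 1) = 0"
    by (simp add: b_def final_boundaries_top sub(3))
  then have "(\<Sum>i<CARD('r). (- 1) ^ i * h (int i)) = (\<Sum>i<CARD('r). (- 1) ^ i * q (int i))"
    by (simp add: telescope)
  also have "\<dots> = (\<Sum>i<CARD('r). \<Sum>I\<in>{I. card I = i}.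
      (- 1) ^ card I * int (codim scale (M I) (M (insert final_index I))))"
    by (simp add: q_def codim_chains degree_indices_def sum_distrib_left)
  also have "\<dots> = (\<Sum>I\<in>{I. card I < CARD('r)}. (- 1) ^ card I * int (codim scale (M I) (M (insert final_index I))))"
  proof -
    have "{I \<in> {I :: 'r set. card I < CARD('r)}. card I = i} = {I. card I = i}" if "i < CARD('r)" for i
      using that by auto
    then show ?thesis
      by (subst sum.group[where g = card and T = "{..<CARD('r)}", symmetric]) auto
  qed
  also have "\<dots> = (\<Sum>K\<in>Pow (- {final_index}). (- 1) ^ card K * int (codim scale (M K) (M (insert final_index K))))"
  proof (rule sum.mono_neutral_right)
    show "Pow (- {final_index}) \<subseteq> {I. card I < CARD('r)}"
      by (auto intro!: psubset_card_mono)
  qed (auto simp: insert_absorb subspace_M)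
  finally show "(\<Sum>i<CARD('r). (- 1) ^ i * int (codim cscale (cycles (int i)) (boundaries (int i))))
      = (\<Sum>K\<in>Pow (- {final_index}). (- 1) ^ card K * int (codim scale (M K) (M (insert final_index K))))"
    by (simp add: h_def)
qed

end

section \<open>Valuations on the local ring of a germ\<close>

lemma val_ge_0 [simp]: "val_ge \<nu> 0 n"
  by (simp add: val_ge_def)

lemma val_ge_mono: "val_ge \<nu> x n \<Longrightarrow> m \<le> n \<Longrightarrow> val_ge \<nu> x m"
  by (auto simp: val_ge_def)

lemma val_ge_add: "discrete_valuation \<nu> \<Longrightarrow> val_ge \<nu> x n \<Longrightarrow> val_ge \<nu> y n \<Longrightarrow> val_ge \<nu> (x + y) n"
  unfolding discrete_valuation_def val_ge_def
  by (cases "x = 0 \<or> y = 0") (auto intro: order_trans[of n "min _ _"])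

lemma val_ge_mult:
  "discrete_valuation \<nu> \<Longrightarrow> val_ge \<nu> x m \<Longrightarrow> val_ge \<nu> y n \<Longrightarrow> val_ge \<nu> (x * y) (m + n)"
  unfolding discrete_valuation_def val_ge_def by (metis add_mono mult_zero_left mult_zero_right)

locale valued_germ =
  fixes \<iota> :: "complex \<Rightarrow> 'k::field" and A R :: "'k set" and ev :: "'k \<Rightarrow> complex"
    and \<nu> :: "'r::{finite,linorder} \<Rightarrow> 'k \<Rightarrow> int"
  assumes germ: "variety_germ \<iota> A ev" and R_eq: "R = local_ring A ev"
    and valuation: "\<And>j. discrete_valuation (\<nu> j)"
    and R_le_valuation_ring: "\<And>j. R \<subseteq> valuation_ring (\<nu> j)"
    and center_final: "center R (\<nu> (Max UNIV)) = local_max_ideal A ev"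
begin

sublocale \<iota>: field_hom \<iota>
  using germ by (simp add: variety_germ_def)

definition smul :: "complex \<Rightarrow> 'k \<Rightarrow> 'k" where
  "smul c x = \<iota> c * x"

sublocale K: relative_dimension smul
  by unfold_locales (simp_all add: smul_def algebra_simps hom_distribs)

lemma A_closed:
  "\<iota> c \<in> A" "x \<in> A \<Longrightarrow> y \<in> A \<Longrightarrow> x + y \<in> A" "x \<in> A \<Longrightarrow> y \<in> A \<Longrightarrow> x * y \<in> A"
  using germ by (auto simp: variety_germ_def intro: generated_algebra.intros)

lemma A_diff: "x \<in> A \<Longrightarrow> y \<in> A \<Longrightarrow> x - y \<in> A"
  using A_closed(2)[of x "\<iota> (- 1) * y"] A_closed(3)[OF A_closed(1)[of "- 1"]]
  by (simp add: hom_distribs)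

lemma ev_hom:
  "ev (\<iota> c) = c" "x \<in> A \<Longrightarrow> y \<in> A \<Longrightarrow> ev (x + y) = ev x + ev y"
  "x \<in> A \<Longrightarrow> y \<in> A \<Longrightarrow> ev (x * y) = ev x * ev y"
  using germ by (auto simp: variety_germ_def Ring.ring_hom_def)

lemma ev_0 [simp]: "ev 0 = 0"
  using ev_hom(1)[of 0] by simp

lemma ev_diff: "x \<in> A \<Longrightarrow> y \<in> A \<Longrightarrow> ev (x - y) = ev x - ev y"
  using ev_hom(2)[of "x - y" y] A_diff by (simp add: algebra_simps)

lemma R_I: "a \<in> A \<Longrightarrow> s \<in> A \<Longrightarrow> ev s \<noteq> 0 \<Longrightarrow> a / s \<in> R"
  by (auto simp: R_eq local_ring_def)

lemma R_E:
  assumes "x \<in> R"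
  obtains a s where "x = a / s" "a \<in> A" "s \<in> A" "ev s \<noteq> 0" "s \<noteq> 0"
  using assms by (fastforce simp: R_eq local_ring_def)

lemma A_le_R: "x \<in> A \<Longrightarrow> x \<in> R"
  using R_I[of x "\<iota> 1"] A_closed(1)[of 1] ev_hom(1)[of 1] by simp

lemma R_mult:
  assumes "x \<in> R" "y \<in> R"
  shows "x * y \<in> R"
proof -
  obtain a s b t where "x = a / s" "a \<in> A" "s \<in> A" "ev s \<noteq> 0" "y = b / t" "b \<in> A" "t \<in> A" "ev t \<noteq> 0"
    using assms by (metis R_E)
  then show ?thesis
    using R_I[of "a * b" "s * t"] by (simp add: A_closed ev_hom)
qed

lemma R_add:
  assumes "x \<in> R" "y \<in> R"
  shows "x + y \<in> R"
proof -
  obtain a s b t where "x = a / s" "a \<in> A" "s \<in> A" "ev s \<noteq> 0" "s \<noteq> 0"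
    "y = b / t" "b \<in> A" "t \<in> A" "ev t \<noteq> 0" "t \<noteq> 0"
    using assms by (metis R_E)
  then show ?thesis
    using R_I[of "a * t + b * s" "s * t"] by (simp add: A_closed ev_hom add_frac_eq)
qed

lemma subspace_R: "K.subspace R"
  using A_le_R[OF A_closed(1)] A_le_R[OF A_closed(1)[of 0]]
  by (auto simp: K.subspace_def smul_def R_add R_mult)

lemma R_val_ge_0: "x \<in> R \<Longrightarrow> val_ge (\<nu> j) x 0"
  using R_le_valuation_ring[of j] by (auto simp: valuation_ring_def)

lemma val_ge_smul: "val_ge (\<nu> j) x n \<Longrightarrow> val_ge (\<nu> j) (smul c x) n"
  using val_ge_mult[OF valuation R_val_ge_0[OF A_le_R[OF A_closed(1)]], of j x n c]
  by (simp add: smul_def)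

abbreviation M :: "('r \<Rightarrow> int) \<Rightarrow> 'k set" where
  "M \<equiv> filtration R \<nu>"

lemma subspace_filtration: "K.subspace (M v)"
  using K.subspace_0[OF subspace_R] K.subspace_add[OF subspace_R] K.subspace_scale[OF subspace_R]
  by (auto simp: K.subspace_def filtration_def val_ge_add[OF valuation] val_ge_smul)

lemma filtration_antimono: "v \<le> w \<Longrightarrow> M w \<subseteq> M v"
  by (auto simp: filtration_def le_fun_def intro: val_ge_mono)

text \<open>
  Conditions with nonpositive bounds hold on the whole local ring and can be exchanged freely.
\<close>

lemma filtration_cong_nonpos:
  assumes "\<And>j. w j \<noteq> v j \<Longrightarrow> v j \<le> 0 \<and> w j \<le> 0"
  shows "M v = M w"
proof -
  have "val_ge (\<nu> j) g (v j) \<longleftrightarrow> val_ge (\<nu> j) g (w j)" if "g \<in> R" for g j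
    using assms[of j] R_val_ge_0[OF that, of j] by (cases "w j = v j") (auto intro: val_ge_mono)
  then show ?thesis by (auto simp: filtration_def)
qed


section \<open>Finiteness at the centered valuation\<close>

definition final_filtration :: "int \<Rightarrow> 'k set" where
  "final_filtration n = {g \<in> R. val_ge (\<nu> (Max UNIV)) g n}"

lemma subspace_final_filtration: "K.subspace (final_filtration n)"
  using K.subspace_0[OF subspace_R] K.subspace_add[OF subspace_R] K.subspace_scale[OF subspace_R]
  by (auto simp: K.subspace_def final_filtration_def val_ge_add[OF valuation] val_ge_smul)

text \<open>
  The maximal ideal is generated by the finitely many functions \<open>y s = s - s(o)\<close>, where \<open>s\<close> runs
  over generators of the coordinate ring. So a function is a constant plus a
  combination of the \<open>y s\<close>, whose coefficients are approximated up to order \<open>n\<close> by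
  induction. Multiplication by \<open>y s\<close> raises the order by at least one.
\<close>

lemma final_filtration_finite_span:
  "\<exists>B. finite B \<and> B \<subseteq> R \<and> R \<subseteq> K.span (B \<union> final_filtration (int n))"
proof (induction n)
  case 0
  have "R \<subseteq> final_filtration 0" using R_val_ge_0 by (auto simp: final_filtration_def)
  then show ?case by (intro exI[of _ "{}"]) (auto intro: K.span_base)
next
  case (Suc n)
  obtain B where B: "finite B" "B \<subseteq> R" "R \<subseteq> K.span (B \<union> final_filtration (int n))"
    using Suc by blast
  obtain S where S: "finite S" "A = generated_algebra \<iota> S"
    using germ by (auto simp: variety_germ_def)
  have SA: "s \<in> A" if "s \<in> S" for s using that S(2) by (auto intro: generated_algebra.gen)
  define y where "y s = s - \<iota> (ev s)" for s
  have yA: "y s \<in> A" "ev (y s) = 0" if "s \<in> S" for s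
    using SA[OF that] A_closed(1) by (simp_all add: y_def A_diff ev_diff ev_hom(1))
  have y_val: "val_ge (\<nu> (Max UNIV)) (y s) 1" if "s \<in> S" for s
  proof -
    have "y s / \<iota> 1 \<in> local_max_ideal A ev"
      using yA[OF that] A_closed(1) ev_hom(1)[of 1] unfolding local_max_ideal_def
      by (metis (mono_tags, lifting) mem_Collect_eq zero_neq_one)
    then show ?thesis using center_final by (auto simp: center_def)
  qed
  define B' where "B' = insert 1 ((\<lambda>(s, b). y s * b) ` (S \<times> B))"
  define T where "T = K.span (B' \<union> final_filtration (int (Suc n)))"
  have T: "K.subspace T" unfolding T_def by (rule K.subspace_span)
  \<comment> \<open>The elements of \<open>A\<close> for which the claim holds even after multiplication by any germ: an ideal of \<open>A\<close>, which is shown to contain every function vanishing at the point.\<close>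
  define Q where "Q = {x \<in> A. \<forall>g\<in>R. x * g \<in> T}"
  have y_Q: "y s \<in> Q" if s: "s \<in> S" for s
  proof -
    have "y s * smul c g = smul c (y s * g)" for c g by (simp add: smul_def)
    then have "K.subspace {g. y s * g \<in> T}"
      using K.subspace_0[OF T] K.subspace_add[OF T] K.subspace_scale[OF T]
      by (auto simp: K.subspace_def distrib_left)
    moreover have "y s * g \<in> T" if "g \<in> B" for g
      using that s by (auto simp: T_def B'_def intro!: K.span_base)
    moreover have "y s * g \<in> T" if "g \<in> final_filtration (int n)" for g
    proof -
      have "y s * g \<in> final_filtration (int (Suc n))"
        using that val_ge_mult[OF valuation y_val[OF s], of g "int n"] A_le_R[OF yA(1)[OF s]]
        by (auto simp: final_filtration_def R_mult)
      then show ?thesis by (auto simp: T_def intro!: K.span_base)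
    qed
    ultimately have "K.span (B \<union> final_filtration (int n)) \<subseteq> {g. y s * g \<in> T}"
      by (intro K.span_minimal) auto
    with B(3) yA(1)[OF s] show ?thesis by (auto simp: Q_def)
  qed
  have Q_add: "x + x' \<in> Q" if "x \<in> Q" "x' \<in> Q" for x x'
    using that A_closed(2) K.subspace_add[OF T] by (auto simp: Q_def distrib_right)
  have Q_mult: "x * a \<in> Q" if "x \<in> Q" "a \<in> A" for x a
    using that A_closed(3) R_mult[OF A_le_R[OF that(2)]] by (auto simp: Q_def mult.assoc)
  have A_Q: "a - \<iota> (ev a) \<in> Q" if "a \<in> generated_algebra \<iota> S" for a
    using that
  proof induction
    case (const c)
    have "(0 :: 'k) \<in> A" using A_closed(1)[of 0] by simp
    then show ?case using K.subspace_0[OF T] by (simp add: ev_hom Q_def)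
  next
    case (gen s)
    then show ?case using y_Q by (simp add: y_def)
  next
    case (add a b)
    then have "a + b - \<iota> (ev (a + b)) = (a - \<iota> (ev a)) + (b - \<iota> (ev b))"
      by (simp add: ev_hom S(2) hom_distribs)
    with add Q_add show ?case by presburger
  next
    case (mult a b)
    then have "a * b - \<iota> (ev (a * b)) = (a - \<iota> (ev a)) * b + (b - \<iota> (ev b)) * \<iota> (ev a)"
      by (simp add: ev_hom S(2) hom_distribs algebra_simps)
    moreover have "(a - \<iota> (ev a)) * b \<in> Q" "(b - \<iota> (ev b)) * \<iota> (ev a) \<in> Q"
      using mult S(2) by (auto intro: Q_mult A_closed(1))
    ultimately show ?case using Q_add by simp
  qed
  have "x \<in> T" if "x \<in> R" for x
  proof -
    obtain a s where x: "x = a / s" "a \<in> A" "s \<in> A" "ev s \<noteq> 0" "s \<noteq> 0"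
      using R_E[OF \<open>x \<in> R\<close>] by blast
    define c where "c = ev a / ev s"
    define b where "b = a - \<iota> c * s"
    have b: "b \<in> A" "ev b = 0"
      using x by (simp_all add: b_def c_def A_diff A_closed ev_diff ev_hom)
    have "b \<in> Q" using A_Q[of b] b S(2) by simp
    moreover have "1 / s \<in> R" using R_I[of "\<iota> 1" s] x A_closed(1)[of 1] by simp
    ultimately have "b * (1 / s) \<in> T" unfolding Q_def by blast
    moreover have "smul c 1 \<in> T"
      by (intro K.subspace_scale[OF T]) (auto simp: T_def B'_def intro: K.span_base)
    ultimately have "smul c 1 + b * (1 / s) \<in> T" by (rule K.subspace_add[OF T, rotated])
    moreover have "x = smul c 1 + b * (1 / s)"
      using x by (simp add: smul_def b_def field_simps)
    ultimately show ?thesis by simp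
  qed
  moreover have "finite B'" using S(1) B(1) by (simp add: B'_def)
  moreover have "B' \<subseteq> R"
    using A_le_R[OF A_closed(1)[of 1]] A_le_R[OF yA(1)] B(2) by (auto simp: B'_def intro!: R_mult)
  ultimately show ?case by (auto simp: T_def intro!: exI[of _ B'])
qed

lemma fin_codim_final_filtration: "fin_codim smul R (final_filtration n)"
proof -
  have "final_filtration n = final_filtration (int (nat n))"
    using R_val_ge_0 by (cases "0 \<le> n") (auto simp: final_filtration_def intro: val_ge_mono)
  moreover have "final_filtration n \<subseteq> R" by (auto simp: final_filtration_def)
  ultimately show ?thesis
    using final_filtration_finite_span[of "nat n"]
    by (simp add: K.fin_codim_iff_span subspace_R subspace_final_filtration)
qed

text \<open>
  The space \<open>M(v + e_r)\<close> is cut out from \<open>M(v)\<close> by one more condition on the last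
  valuation alone, and that condition has finite codimension in the whole local ring.
\<close>

lemma fin_codim_final: "fin_codim smul (M v) (M (v + exponent_vec {Max UNIV}))"
proof -
  let ?r = "Max UNIV :: 'r"
  have e: "(v + exponent_vec {?r}) j = (if j = ?r then v j + 1 else v j)" for j
    by (simp add: exponent_vec_def)
  have "(\<forall>j. val_ge (\<nu> j) g (if j = ?r then v j + 1 else v j)) \<longleftrightarrow>
      (\<forall>j. val_ge (\<nu> j) g (v j)) \<and> val_ge (\<nu> ?r) g (v ?r + 1)" for g
    using val_ge_mono[of "\<nu> ?r" g "v ?r + 1" "v ?r"] by (smt (verit) zle_add1_eq_le)
  then have "M (v + exponent_vec {?r}) = M v \<inter> final_filtration (v ?r + 1)"
    unfolding filtration_def final_filtration_def e by blast
  moreover have "fin_codim smul (M v) (M v \<inter> final_filtration (v (Max UNIV) + 1))"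
    by (rule K.fin_codim_Int[OF subspace_R subspace_filtration subspace_final_filtration
          _ _ fin_codim_final_filtration])
      (auto simp: final_filtration_def filtration_def)
  ultimately show ?thesis by simp
qed

section \<open>Homology of the complex of a germ\<close>

lemma filtration_quotient_presentation:
  assumes "v \<le> w"
  shows "quotient_presentation smul (M v) (M w) (filtration_quotient \<iota> R \<nu> v w)
    (\<lambda>x. (\<lambda>z. z + x) ` M w)"
proof -
  let ?U = "(field_module \<iota>)\<lparr>carrier := M v\<rparr>"
  interpret quotient_presentation smul "M v" "{0}" ?U id
    by unfold_locales
      (auto simp: field_module_def smul_def subspace_filtration K.subspace_0)
  have "M w +>\<^bsub>?U\<^esub> x = (\<lambda>z. z + x) ` M w" for x
    by (auto simp: a_r_coset_def' field_module_def)
  with quotient[of "M w"] filtration_antimono[OF assms] show ?thesis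
    by (simp add: filtration_quotient_def subspace_filtration K.subspace_0)
qed

lemma exponent_vec_UNIV: "exponent_vec UNIV = (1 :: 'r \<Rightarrow> int)"
  by (simp add: exponent_vec_def fun_eq_iff)

lemma exponent_vec_mono: "I \<subseteq> J \<Longrightarrow> exponent_vec I \<le> (exponent_vec J :: 'r \<Rightarrow> int)"
  by (auto simp: exponent_vec_def le_fun_def)

lemma exponent_vec_insert: "a \<notin> I \<Longrightarrow> exponent_vec (insert a I) = exponent_vec I + (exponent_vec {a} :: 'r \<Rightarrow> int)"
  by (auto simp: exponent_vec_def fun_eq_iff)

lemma decreasing_family_filtration:
  "decreasing_family smul (\<lambda>I. M (v + exponent_vec I))"
  by unfold_locales
    (auto simp: subspace_filtration intro!: filtration_antimono exponent_vec_mono add_left_mono)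

text \<open>
  The homology spaces, built from families of cosets, are presented by the cycles and boundaries
  of the lifted complex. The complex of direct sums is presented in each degree by taking
  cosets componentwise, and this is compatible with the boundary maps.
\<close>

lemma homology_presentation:
  fixes v :: "'r \<Rightarrow> int"
  defines "N \<equiv> \<lambda>I. M (v + exponent_vec I)"
  shows "\<exists>p. quotient_presentation (fun_scale smul) (decreasing_family.cycles smul N i)
    (decreasing_family.boundaries smul N i) (homology_space \<iota> R \<nu> v i) p"
proof -
  interpret D: decreasing_family smul N
    unfolding N_def by (rule decreasing_family_filtration)
  have N_UNIV: "N UNIV = M (v + 1)" by (simp add: N_def exponent_vec_UNIV)
  let ?V = "complex_summand \<iota> R \<nu> v"
  let ?p = "\<lambda>x. (\<lambda>z. z + x) ` N UNIV"
  define \<pi> where "\<pi> i x = (\<lambda>I\<in>D.degree_indices i. ?p (x I))" for i and x :: "'r set \<Rightarrow> 'k"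
  have V: "quotient_presentation smul (N I) (N UNIV) (?V I) ?p" for I
    unfolding N_UNIV unfolding N_def
    by (rule filtration_quotient_presentation)
      (use exponent_vec_mono[of I UNIV] in \<open>simp add: exponent_vec_UNIV\<close>)
  have C: "quotient_presentation (fun_scale smul) (D.chains i) (D.null_chains i)
      (chain_space \<iota> R \<nu> v i) (\<pi> i)" for i
    using K.direct_sum_presentation[OF V]
    unfolding chain_space_def D.chains_def D.null_chains_def \<pi>_def[abs_def] D.degree_indices_def .
  have bd: "boundary \<iota> R \<nu> v i (\<pi> i x) = \<pi> (i - 1) (D.bd x)" if x: "x \<in> D.chains i" for i x
  proof
    fix J
    show "boundary \<iota> R \<nu> v i (\<pi> i x) J = \<pi> (i - 1) (D.bd x) J"
    proof (cases "int (card J) = i - 1")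
      case True
      interpret VJ: quotient_presentation smul "N J" "N UNIV" "?V J" ?p by (rule V)
      interpret VS: vectorspace class_ring "?V J" by (rule VJ.vectorspace)
      have deg: "insert a J \<in> D.degree_indices i" if "a \<in> - J" for a
        using that True by (simp add: D.degree_indices_def)
      have xN: "x (insert a J) \<in> N J" if "a \<in> - J" for a
      proof -
        have "x (insert a J) \<in> N (insert a J)"
          using x deg[OF that] unfolding D.chains_def sections_def mem_Collect_eq by metis
        then show ?thesis using D.M_antimono[OF subset_insertI] by blast
      qed
      have "boundary \<iota> R \<nu> v i (\<pi> i x) J
          = (\<Oplus>\<^bsub>?V J\<^esub>a\<in>- J. D.incidence_sign a J \<odot>\<^bsub>?V J\<^esub> \<pi> i x (insert a J))"
        using True by (simp add: boundary_def D.incidence_sign_def)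
      also have "\<dots> = (\<Oplus>\<^bsub>?V J\<^esub>a\<in>- J. ?p (smul (D.incidence_sign a J) (x (insert a J))))"
      proof (rule VS.M.finsum_cong'[OF refl])
        show "(\<lambda>a. ?p (smul (D.incidence_sign a J) (x (insert a J)))) \<in> - J \<rightarrow> carrier (?V J)"
          using xN K.subspace_scale[OF VJ.subspace_U] by (auto simp: VJ.carrier)
        fix a assume a: "a \<in> - J"
        have "\<pi> i x (insert a J) = ?p (x (insert a J))" using deg[OF a] by (simp add: \<pi>_def)
        then show "D.incidence_sign a J \<odot>\<^bsub>?V J\<^esub> \<pi> i x (insert a J)
            = ?p (smul (D.incidence_sign a J) (x (insert a J)))"
          using VJ.smult[OF xN[OF a]] by simp
      qed
      also have "\<dots> = ?p (D.bd x J)"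
        unfolding D.bd_def
        by (rule VJ.finsum[symmetric]) (use xN K.subspace_scale[OF VJ.subspace_U] in auto)
      finally show ?thesis using True by (simp add: \<pi>_def D.degree_indices_def)
    qed (simp add: boundary_def \<pi>_def D.degree_indices_def)
  qed
  have ker: "a_kernel (chain_space \<iota> R \<nu> v i) (chain_space \<iota> R \<nu> v (i - 1)) (boundary \<iota> R \<nu> v i)
      = \<pi> i ` D.cycles i"
  proof -
    have "boundary \<iota> R \<nu> v i (\<pi> i x) = \<zero>\<^bsub>chain_space \<iota> R \<nu> v (i - 1)\<^esub> \<longleftrightarrow> D.bd x \<in> D.null_chains (i - 1)"
      if "x \<in> D.chains i" for x
      using quotient_presentation.kernel[OF C D.bd_chains[OF that]] bd[OF that] by simp
    then show ?thesis
      by (auto simp: a_kernel_def kernel_def quotient_presentation.carrier[OF C] D.cycles_def)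
  qed
  have im: "boundary \<iota> R \<nu> v (i + 1) ` carrier (chain_space \<iota> R \<nu> v (i + 1)) = \<pi> i ` D.boundaries i"
  proof -
    have "boundary \<iota> R \<nu> v (i + 1) ` carrier (chain_space \<iota> R \<nu> v (i + 1))
        = (\<lambda>c. \<pi> i (D.bd c)) ` D.chains (i + 1)"
      unfolding quotient_presentation.carrier[OF C] image_image using bd[of _ "i + 1"]
      by (intro image_cong) simp_all
    also have "\<dots> = \<pi> i ` D.boundaries i"
    proof -
      have eq: "\<pi> i (D.bd c + n) = \<pi> i (D.bd c)" if "c \<in> D.chains (i + 1)" "n \<in> D.null_chains i" for c n
      proof -
        have "D.bd c \<in> D.chains i" using D.bd_chains[OF that(1)] by simp
        moreover have "n \<in> D.chains i" using that(2) D.null_le_final D.final_le_chains by blast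
        ultimately show ?thesis
          using that(2) D.F.subspace_add[OF D.subspace_chains(1)]
          by (subst quotient_presentation.eq_iff[OF C]) auto
      qed
      have "D.bd c \<in> D.boundaries i" if "c \<in> D.chains (i + 1)" for c
      proof -
        have "D.bd c = D.bd c + 0" by simp
        with that D.F.subspace_0[OF D.subspace_chains(2)] show ?thesis
          unfolding D.boundaries_def by blast
      qed
      with eq show ?thesis by (auto simp: D.boundaries_def image_iff)
    qed
    finally show ?thesis .
  qed
  have Z: "quotient_presentation (fun_scale smul) (D.cycles i) (D.null_chains i)
      ((chain_space \<iota> R \<nu> v i)\<lparr>carrier := \<pi> i ` D.cycles i\<rparr>) (\<pi> i)"
    by (rule quotient_presentation.restrict[OF C D.subspace_cycles(1)])
      (use D.null_le_boundaries D.boundaries_le_cycles in \<open>auto simp: D.cycles_def\<close>)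
  show ?thesis
    unfolding homology_space_def ker im
    using quotient_presentation.quotient[OF Z D.subspace_cycles(2) D.null_le_boundaries D.boundaries_le_cycles]
    by blast
qed

end

section \<open>Laurent polynomials acting on series\<close>

lemma laurent_times_add: "laurent_times (p + q) F v = laurent_times p F v + laurent_times q F v"
  using laurent_times_superset[of "Poly_Mapping.keys p \<union> Poly_Mapping.keys q" p F v]
    laurent_times_superset[of "Poly_Mapping.keys p \<union> Poly_Mapping.keys q" q F v]
    laurent_times_superset[of "Poly_Mapping.keys p \<union> Poly_Mapping.keys q" "p + q" F v]
    keys_add[of p q]
  by (simp add: lookup_add distrib_right sum.distrib)

lemma laurent_times_sum:
  "finite I \<Longrightarrow> laurent_times (\<Sum>i\<in>I. p i) F v = (\<Sum>i\<in>I. laurent_times (p i) F v)"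
proof (induction I rule: finite_induct)
  case empty
  show ?case by (simp add: laurent_times_def)
qed (simp add: laurent_times_add)

lemma laurent_times_single: "laurent_times (Poly_Mapping.single a c) F v = c * F (v - a)"
  using laurent_times_superset[of "{a}" "Poly_Mapping.single a c" F v] by (simp add: lookup_single)

lemma prod_laurent_var_subset:
  fixes I :: "'r::finite set"
  shows "(\<Prod>j\<in>I. laurent_var j) = Poly_Mapping.single (exponent_vec I) 1"
proof (induction I rule: finite_induct[OF finite])
  case 1
  have "exponent_vec {} = (0 :: 'r \<Rightarrow> int)" by (simp add: exponent_vec_def fun_eq_iff)
  then show ?case by (simp only: prod.empty single_one)
next
  case (2 a I)
  have "exponent_vec {a} + exponent_vec I = exponent_vec (insert a I)"
    using 2 by (auto simp: exponent_vec_def fun_eq_iff)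
  then show ?case using 2 by (simp add: laurent_var_def mult_single)
qed

text \<open>
  The product expands into the monomials \<open>exponent_vec (- I)\<close> with sign \<open>(- 1) ^ card I\<close>; the
  complements turn the subtraction of the exponent into an addition.
\<close>

lemma laurent_times_prod_var_minus_1:
  fixes F :: "'r::finite series"
  shows "laurent_times (\<Prod>j\<in>UNIV. laurent_var j - 1) F v
    = (\<Sum>I\<in>UNIV. (- 1) ^ card I * F (v - 1 + exponent_vec I))"
proof -
  have m1: "(- 1) ^ n = (Poly_Mapping.single 0 ((- 1) ^ n) :: ('r \<Rightarrow> int) \<Rightarrow>\<^sub>0 int)" for n
  proof (induction n)
    case 0
    show ?case by (simp only: power_0 single_one)
  next
    case (Suc n)
    have "(- 1) ^ Suc n = - ((- 1) ^ n :: ('r \<Rightarrow> int) \<Rightarrow>\<^sub>0 int)" by simp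
    also have "\<dots> = Poly_Mapping.single 0 ((- 1) ^ Suc n)"
      unfolding Suc by (simp flip: single_uminus)
    finally show ?case .
  qed
  have "(\<Prod>j\<in>UNIV. laurent_var j - 1 :: ('r \<Rightarrow> int) \<Rightarrow>\<^sub>0 int)
      = (\<Sum>I\<in>UNIV. Poly_Mapping.single (exponent_vec (- I)) ((- 1) ^ card I))"
    by (simp add: prod_diff_conv_sum prod_laurent_var_subset m1 mult_single Compl_eq_Diff_UNIV[symmetric])
  moreover have "v - exponent_vec (- I) = v - 1 + exponent_vec I" for I :: "'r set"
    by (auto simp: exponent_vec_def fun_eq_iff)
  ultimately show ?thesis
    by (simp only: laurent_times_sum[OF finite] laurent_times_single)
qed

lemma sum_Pow_insert:
  assumes "finite S" "a \<notin> S"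
  shows "(\<Sum>K\<in>Pow (insert a S). g K) = (\<Sum>K\<in>Pow S. g K + g (insert a K))"
proof -
  have "inj_on (insert a) (Pow S)" using assms(2) by (auto simp: inj_on_def)
  moreover have "Pow S \<inter> insert a ` Pow S = {}" using assms(2) by auto
  ultimately show ?thesis
    using assms(1) by (simp add: Pow_insert sum.union_disjoint sum.reindex sum.distrib)
qed

section \<open>Comparison of the Poincare series\<close>

context valued_germ begin

lemma fin_dim_filtration_quotient_iff:
  "v \<le> w \<Longrightarrow> fin_dim\<^sub>C (filtration_quotient \<iota> R \<nu> v w) \<longleftrightarrow> fin_codim smul (M v) (M w)"
  by (rule presentation_fin_dim_iff[OF filtration_quotient_presentation])

lemma dim_filtration_quotient:
  "v \<le> w \<Longrightarrow> fin_codim smul (M v) (M w) \<Longrightarrow>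
    dim\<^sub>C (filtration_quotient \<iota> R \<nu> v w) = codim smul (M v) (M w)"
  by (rule presentation_dim_eq[OF filtration_quotient_presentation])

lemma le_add_exponent_vec: "v \<le> v + (exponent_vec I :: 'r \<Rightarrow> int)"
  by (simp add: le_fun_def exponent_vec_def)

lemma fin_codim_insert_final:
  assumes "Max UNIV \<notin> K"
  shows "fin_codim smul (M (v + exponent_vec K)) (M (v + exponent_vec (insert (Max UNIV) K)))"
  using fin_codim_final[of "v + exponent_vec K"] by (simp add: exponent_vec_insert[OF assms] add.assoc)

lemma poincare_series_eq:
  "poincare_series \<iota> R \<nu> v = (\<Sum>K\<in>Pow (- {Max UNIV}). (- 1) ^ card K *
     int (codim smul (M (v + exponent_vec K)) (M (v + exponent_vec (insert (Max UNIV) K)))))"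
  unfolding poincare_series_def
proof (rule sum.cong[OF refl])
  fix K :: "'r set" assume "K \<in> Pow (- {Max UNIV})"
  then have r: "Max UNIV \<notin> K" by auto
  show "(- 1) ^ card K * int (dim\<^sub>C (filtration_quotient \<iota> R \<nu> (v + exponent_vec K)
          (v + exponent_vec K + exponent_vec {Max UNIV})))
      = (- 1) ^ card K * int (codim smul (M (v + exponent_vec K)) (M (v + exponent_vec (insert (Max UNIV) K))))"
    using dim_filtration_quotient[OF le_add_exponent_vec fin_codim_final, of "v + exponent_vec K"]
    by (simp add: exponent_vec_insert[OF r] add.assoc)
qed

lemma homology_euler:
  shows fin_dim_homology: "fin_dim\<^sub>C (homology_space \<iota> R \<nu> v i)"
    and homology_series_eq_poincare_series: "homology_series \<iota> R \<nu> v = poincare_series \<iota> R \<nu> v"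
proof -
  define N where "N I = M (v + exponent_vec I)" for I :: "'r set"
  interpret D: decreasing_family smul N
    unfolding N_def by (rule decreasing_family_filtration)
  have fin: "fin_codim smul (N K) (N (insert D.final_index K))" if "D.final_index \<notin> K" for K
    using that fin_codim_insert_final unfolding D.final_index_def N_def by blast
  have P: "\<exists>p. quotient_presentation (fun_scale smul) (D.cycles i) (D.boundaries i) (homology_space \<iota> R \<nu> v i) p" for i
    using homology_presentation[of v i] unfolding N_def[abs_def] .
  have fin_H: "fin_codim (fun_scale smul) (D.cycles i) (D.boundaries i)" for i
    by (rule D.fin_codim_homology[OF fin])
  show "fin_dim\<^sub>C (homology_space \<iota> R \<nu> v i)"
    using P[of i] fin_H presentation_fin_dim_iff by blast
  have dim: "dim\<^sub>C (homology_space \<iota> R \<nu> v i) = codim (fun_scale smul) (D.cycles i) (D.boundaries i)" for i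
    using P[of i] presentation_dim_eq[OF _ fin_H] by blast
  show "homology_series \<iota> R \<nu> v = poincare_series \<iota> R \<nu> v"
    using D.homology_euler_characteristic(2)[OF fin]
    by (simp add: homology_series_def dim poincare_series_eq N_def D.final_index_def)
qed

text \<open>
  Let \<open>v j\<close> be negative. Then adding \<open>j\<close> to \<open>K\<close> does not change \<open>M(v + e_K)\<close>. If \<open>j\<close> is the last
  index, every summand is zero; otherwise the summands for \<open>K\<close> and \<open>insert j K\<close> cancel.
\<close>

lemma is_power_series_poincare_series: "is_power_series (poincare_series \<iota> R \<nu>)"
  unfolding is_power_series_def
proof (intro allI impI)
  fix v :: "'r \<Rightarrow> int" and j
  assume nz: "poincare_series \<iota> R \<nu> v \<noteq> 0"
  let ?r = "Max UNIV :: 'r"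
  let ?c = "\<lambda>K. (- 1) ^ card K *
     int (codim smul (M (v + exponent_vec K)) (M (v + exponent_vec (insert ?r K))))"
  show "0 \<le> v j"
  proof (rule ccontr)
    assume "\<not> 0 \<le> v j"
    then have j: "M (v + exponent_vec (insert j K)) = M (v + exponent_vec K)" for K
      by (intro filtration_cong_nonpos) (auto simp: exponent_vec_def split: if_splits)
    have "(\<Sum>K\<in>Pow (- {?r}). ?c K) = 0"
    proof (cases "j = ?r")
      case True
      with j show ?thesis by (simp add: subspace_filtration)
    next
      case False
      define S where "S = - {?r, j}"
      have "- {?r} = insert j S" "j \<notin> S" using False by (auto simp: S_def)
      then have "(\<Sum>K\<in>Pow (- {?r}). ?c K) = (\<Sum>K\<in>Pow S. ?c K + ?c (insert j K))"
        by (simp add: sum_Pow_insert)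
      also have "\<dots> = 0"
      proof (rule sum.neutral, rule ballI)
        fix K assume "K \<in> Pow S"
        then have "j \<notin> K" using \<open>j \<notin> S\<close> by auto
        then show "?c K + ?c (insert j K) = 0"
          using j[of "insert ?r K"] by (simp add: j insert_commute[of ?r j])
      qed
      finally show ?thesis .
    qed
    with nz show False by (simp add: poincare_series_eq)
  qed
qed

text \<open>
  All spaces that occur lie between \<open>M(v - 1)\<close> and \<open>M(v + 1)\<close>, and the quotient of these two is
  finite-dimensional. Hence each dimension is a difference of values of a single function \<open>L\<close>, the
  codimension in \<open>M(v - 1)\<close>.
\<close>

lemma classical_numerator_eq:
  assumes fin: "\<And>v. fin_dim\<^sub>C (filtration_quotient \<iota> R \<nu> v (v + 1))"
  shows "classical_numerator \<iota> R \<nu> v = poincare_series \<iota> R \<nu> (v - 1) - poincare_series \<iota> R \<nu> v"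
proof -
  let ?r = "Max UNIV :: 'r"
  have le1: "w \<le> w + 1" for w :: "'r \<Rightarrow> int" by (simp add: le_fun_def)
  have fin1: "fin_codim smul (M w) (M (w + 1))" for w
    using fin[of w] fin_dim_filtration_quotient_iff[OF le1] by blast
  note S = subspace_filtration
  have fin2: "fin_codim smul (M (v - 1)) (M (v + 1))"
  proof -
    have "fin_codim smul (M (v - 1)) (M v)" "M v \<subseteq> M (v - 1)"
      using fin1[of "v - 1"] filtration_antimono[OF le1[of "v - 1"]] by simp_all
    then show ?thesis
      using K.fin_codim_trans[OF S S S filtration_antimono[OF le1]] fin1 by blast
  qed
  define L where "L w = int (codim smul (M (v - 1)) (M w))" for w
  have L: "int (codim smul (M w) (M w')) = L w' - L w"
    if w: "v - 1 \<le> w" "w \<le> w'" "w' \<le> v + 1" for w w'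
  proof -
    have "fin_codim smul (M (v - 1)) (M w')"
      by (rule K.fin_codim_upper[OF S S S filtration_antimono[OF w(3)]
            filtration_antimono[OF order_trans[OF w(1,2)]] fin2])
    then have "codim smul (M (v - 1)) (M w') = codim smul (M (v - 1)) (M w) + codim smul (M w) (M w')"
      by (intro K.codim_add S filtration_antimono w)
    then show ?thesis by (simp add: L_def)
  qed
  have P: "poincare_series \<iota> R \<nu> u = - (\<Sum>I\<in>UNIV. (- 1) ^ card I * L (u + exponent_vec I))"
    if u: "v - 1 \<le> u" "u \<le> v" for u
  proof -
    have bounds: "v - 1 \<le> u + exponent_vec I" "u + exponent_vec I \<le> v + 1" for I :: "'r set"
      using u by (auto simp: le_fun_def exponent_vec_def intro: order_trans add_mono)
        (smt (verit))+
    have "poincare_series \<iota> R \<nu> u = (\<Sum>K\<in>Pow (- {?r}).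
        (- 1) ^ card K * (L (u + exponent_vec (insert ?r K)) - L (u + exponent_vec K)))"
      unfolding poincare_series_eq
      by (intro sum.cong refl arg_cong2[where f = "(*)"] L bounds add_left_mono exponent_vec_mono) auto
    also have "\<dots> = (\<Sum>K\<in>Pow (- {?r}). - ((- 1) ^ card K * L (u + exponent_vec K)
        + (- 1) ^ card (insert ?r K) * L (u + exponent_vec (insert ?r K))))"
    proof (rule sum.cong[OF refl])
      fix K :: "'r set" assume "K \<in> Pow (- {?r})"
      then have "?r \<notin> K" by auto
      then show "(- 1) ^ card K * (L (u + exponent_vec (insert ?r K)) - L (u + exponent_vec K))
          = - ((- 1) ^ card K * L (u + exponent_vec K)
            + (- 1) ^ card (insert ?r K) * L (u + exponent_vec (insert ?r K)))"
        by (simp add: algebra_simps)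
    qed
    also have "\<dots> = - (\<Sum>I\<in>Pow (insert ?r (- {?r})). (- 1) ^ card I * L (u + exponent_vec I))"
      unfolding sum_negf by (subst sum_Pow_insert) simp_all
    also have "Pow (insert ?r (- {?r})) = UNIV" by auto
    finally show ?thesis .
  qed
  have "classical_numerator \<iota> R \<nu> v
      = (\<Sum>I\<in>UNIV. (- 1) ^ card I * hilbert_series \<iota> R \<nu> (v - 1 + exponent_vec I))"
    by (simp add: classical_numerator_def laurent_times_prod_var_minus_1)
  also have "\<dots> = (\<Sum>I\<in>UNIV. (- 1) ^ card I * (L (v + exponent_vec I) - L (v - 1 + exponent_vec I)))"
  proof (intro sum.cong refl arg_cong2[where f = "(*)"])
    fix I :: "'r set"
    have "hilbert_series \<iota> R \<nu> (v - 1 + exponent_vec I)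
        = int (codim smul (M (v - 1 + exponent_vec I)) (M (v - 1 + exponent_vec I + 1)))"
      by (simp add: hilbert_series_def dim_filtration_quotient[OF le1 fin1])
    also have "v - 1 + exponent_vec I + 1 = v + exponent_vec I" by simp
    also have "int (codim smul (M (v - 1 + exponent_vec I)) (M (v + exponent_vec I)))
        = L (v + exponent_vec I) - L (v - 1 + exponent_vec I)"
      by (rule L) (auto simp: le_fun_def exponent_vec_def)
    finally show "hilbert_series \<iota> R \<nu> (v - 1 + exponent_vec I)
        = L (v + exponent_vec I) - L (v - 1 + exponent_vec I)" .
  qed
  also have "\<dots> = poincare_series \<iota> R \<nu> (v - 1) - poincare_series \<iota> R \<nu> v"
    by (subst (1 2) P) (auto simp: le_fun_def right_diff_distrib sum_subtractf)
  finally show ?thesis .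
qed

text \<open>
  Dividing by \<open>t_1 \<cdots> t_r - 1\<close> means solving a difference equation along the diagonal, and
  the Poincare series is its unique solution among power series.
\<close>

lemma poincare_series_eq_classical:
  assumes fin: "\<And>v. fin_dim\<^sub>C (filtration_quotient \<iota> R \<nu> v (v + 1))"
  shows "is_power_series (classical_numerator \<iota> R \<nu>)"
    and "classical_poincare_series \<iota> R \<nu> = poincare_series \<iota> R \<nu>"
proof -
  note eq = classical_numerator_eq[OF fin]
  show pow: "is_power_series (classical_numerator \<iota> R \<nu>)"
    unfolding is_power_series_def
  proof (intro allI impI)
    fix v j assume "classical_numerator \<iota> R \<nu> v \<noteq> 0"
    then have "poincare_series \<iota> R \<nu> (v - 1) \<noteq> 0 \<or> poincare_series \<iota> R \<nu> v \<noteq> 0"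
      by (auto simp: eq)
    then have "0 \<le> (v - 1) j \<or> 0 \<le> v j"
      using is_power_series_poincare_series unfolding is_power_series_def by blast
    then show "0 \<le> v j" by auto
  qed
  have "laurent_times ((\<Prod>j\<in>UNIV. laurent_var j) - 1) (poincare_series \<iota> R \<nu>) = classical_numerator \<iota> R \<nu>"
    by (simp add: fun_eq_iff laurent_times_divisor eq)
  then show "classical_poincare_series \<iota> R \<nu> = poincare_series \<iota> R \<nu>"
    unfolding classical_poincare_series_def power_series_div_def
    by (intro the1_equality power_series_div_unique pow conjI is_power_series_poincare_series)
qed

end

theorem theorem2:
  fixes \<iota> :: "complex \<Rightarrow> 'k::field"
    and A R \<mm> :: "'k set"
    and ev :: "'k \<Rightarrow> complex"
    and \<nu> :: "'r::{finite,linorder} \<Rightarrow> 'k \<Rightarrow> int"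
  assumes "variety_germ \<iota> A ev"
    and "R = local_ring A ev"
    and "\<mm> = local_max_ideal A ev"
    and "\<And>j. discrete_valuation (\<nu> j)"
    and "\<And>j. R \<subseteq> valuation_ring (\<nu> j)"
    and "center R (\<nu> (Max UNIV)) = \<mm>"
  shows "(\<forall>v. \<forall>i<CARD('r). fin_dim\<^sub>C (homology_space \<iota> R \<nu> v (int i)))
    \<and> (\<forall>v K. Max UNIV \<notin> K \<longrightarrow>
         fin_dim\<^sub>C (filtration_quotient \<iota> R \<nu> (v + exponent_vec K)
                                        (v + exponent_vec K + exponent_vec {Max UNIV})))
    \<and> homology_series \<iota> R \<nu> = poincare_series \<iota> R \<nu>
    \<and> ((\<forall>v. fin_dim\<^sub>C (filtration_quotient \<iota> R \<nu> v (v + 1))) \<longrightarrow>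
         is_power_series (classical_numerator \<iota> R \<nu>)
         \<and> homology_series \<iota> R \<nu> = classical_poincare_series \<iota> R \<nu>)"
proof -
  interpret valued_germ \<iota> A R ev \<nu>
    using assms by unfold_locales auto
  show ?thesis
  proof (intro conjI allI impI)
    show eq: "homology_series \<iota> R \<nu> = poincare_series \<iota> R \<nu>"
      by (rule ext) (rule homology_series_eq_poincare_series)
    assume "\<forall>v. fin_dim\<^sub>C (filtration_quotient \<iota> R \<nu> v (v + 1))"
    then show "is_power_series (classical_numerator \<iota> R \<nu>)"
      "homology_series \<iota> R \<nu> = classical_poincare_series \<iota> R \<nu>"
      using poincare_series_eq_classical eq by simp_all
  next
    fix v :: "'r \<Rightarrow> int" and K
    show "fin_dim\<^sub>C (filtration_quotient \<iota> R \<nu> (v + exponent_vec K)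
        (v + exponent_vec K + exponent_vec {Max UNIV}))"
      unfolding fin_dim_filtration_quotient_iff[OF le_add_exponent_vec] by (rule fin_codim_final)
  qed (rule fin_dim_homology)
qed

end
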